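(* Let $m=2\ell$ with $\ell\ge 1$, and let $\mathfrak{I}^{(m)}$ be the set of all involutions having no descending subsequence of length $m+1$. Write $\bar x_j=1/x_j$. Then the ordinary generating function of these involutions is $$\sum_{\tau\in\mathfrak{I}^{(m)}}t^{|\tau|}=\left[x_1^0x_2^1\cdots x_\ell^{\ell-1}\right]\ \frac{\det\left(x_j^{i-1}+\bar x_j^i\right)_{1\le i,j\le\ell}}{1-t(x_1+\cdots+x_\ell+\bar x_1+\cdots+\bar x_\ell)}.$$ Equivalently, their exponential generating function is $$\sum_{\tau\in\mathfrak{I}^{(m)}}\frac{t^{|\tau|}}{|\tau|!}=\left[x_1^0x_2^1\cdots x_\ell^{\ell-1}\right]\ \det\left((x_j^{i-1}+\bar x_j^i)\,e^{t(x_j+\bar x_j)}\right)_{1\le i,j\le\ell}.$$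
   Context: An involution of length $n$ is a permutation $\tau$ of $\{1,\dots,n\}$ with $\tau\circ\tau=\mathrm{id}$; $|\tau|=n$, and the empty permutation (length $0$) is included. A descending subsequence of length $k$ is a $k$-tuple $(\tau(i_1),\dots,\tau(i_k))$ with $i_1<\cdots<i_k$ and $\tau(i_1)>\cdots>\tau(i_k)$. The expressions on the right are regarded as formal power series in $t$ with coefficients in the Laurent polynomial ring $\mathbb{Q}[x_1,\bar x_1,\dots,x_\ell,\bar x_\ell]$, and $[x_1^0x_2^1\cdots x_\ell^{\ell-1}]$ denotes extraction (coefficientwise in $t$) of the coefficient of the monomial $x_1^0x_2^1\cdots x_\ell^{\ell-1}$. *)

theory Defs
  imports
    "HOL-Library.Poly_Mapping"
    "HOL-Combinatorics.Permutations"
    "HOL-Computational_Algebra.Formal_Power_Series"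
    "Jordan_Normal_Form.Determinant"
begin

subsection \<open>Involutions without long descending subsequences\<close>

text \<open>
  An involution is a pair of its length \<open>n\<close> and a permutation of \<open>{1..n}\<close>. The length has to be
  recorded because \<open>permutes\<close> extends a permutation by the identity: as functions, an involution
  of \<open>{1..n}\<close> is also one of \<open>{1..n + 1}\<close>.
\<close>

definition involutions :: "(nat \<times> (nat \<Rightarrow> nat)) set" where
  "involutions = {(n, \<tau>). \<tau> permutes {1..n} \<and> \<tau> \<circ> \<tau> = id}"

definition has_descending_subseq :: "nat \<Rightarrow> nat \<times> (nat \<Rightarrow> nat) \<Rightarrow> bool" where
  "has_descending_subseq k = (\<lambda>(n, \<tau>). \<exists>is. length is = k \<and> set is \<subseteq> {1..n} \<and>
     sorted_wrt (<) is \<and> sorted_wrt (>) (map \<tau> is))"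

definition involutions_avoiding :: "nat \<Rightarrow> (nat \<times> (nat \<Rightarrow> nat)) set" where
  "involutions_avoiding m = {\<sigma> \<in> involutions. \<not> has_descending_subseq (m + 1) \<sigma>}"

lemma finite_involutions_of_length: "finite {\<sigma> \<in> involutions. fst \<sigma> = n}"
proof (rule finite_subset)
  show "{\<sigma> \<in> involutions. fst \<sigma> = n} \<subseteq> {n} \<times> {\<tau>. \<tau> permutes {1..n}}"
    by (auto simp: involutions_def)
qed (simp add: finite_permutations)

subsection \<open>Generating functions of a class whose elements of each len are finitely many\<close>

definition ordinary_gf :: "'a set \<Rightarrow> ('a \<Rightarrow> nat) \<Rightarrow> rat fps" where
  "ordinary_gf A len = Abs_fps (\<lambda>n. \<Sum>a | a \<in> A \<and> len a = n. 1)"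

definition exponential_gf :: "'a set \<Rightarrow> ('a \<Rightarrow> nat) \<Rightarrow> rat fps" where
  "exponential_gf A len = Abs_fps (\<lambda>n. \<Sum>a | a \<in> A \<and> len a = n. 1 / fact (len a))"

subsection \<open>Laurent polynomials\<close>

text \<open>
  A Laurent polynomial is a finitely supported map from exponent vectors to coefficients, the
  exponent vectors being finitely supported maps from variable indices to integers; the
  product of \<^theory>\<open>HOL-Library.Poly_Mapping\<close> is the convolution product. The type has a
  variable for every natural number and so contains the Laurent polynomial ring in
  \<open>x\<^sub>1, \<dots>, x\<^sub>l\<close> for every \<open>l\<close>.
\<close>

type_synonym laurent = "(nat \<Rightarrow>\<^sub>0 int) \<Rightarrow>\<^sub>0 rat"

definition X :: "nat \<Rightarrow> laurent" where
  "X j = Poly_Mapping.single (Poly_Mapping.single j 1) 1"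

definition Xbar :: "nat \<Rightarrow> laurent" where
  "Xbar j = Poly_Mapping.single (Poly_Mapping.single j (- 1)) 1"

lemma X_mult_Xbar: "X j * Xbar j = 1"
  by (simp add: X_def Xbar_def mult_single flip: single_add)

text \<open>The exponent vector of \<open>x\<^sub>1\<^sup>0 x\<^sub>2\<^sup>1 \<dots> x\<^sub>l\<^bsup>l-1\<^esup>\<close>.\<close>

definition staircase :: "nat \<Rightarrow> (nat \<Rightarrow>\<^sub>0 int)" where
  "staircase l = (\<Sum>j = 1..l. Poly_Mapping.single j (int j - 1))"

lemma prod_X_staircase: "(\<Prod>j = 1..l. X j ^ (j - 1)) = Poly_Mapping.single (staircase l) 1"
proof -
  have pow: "X j ^ k = Poly_Mapping.single (Poly_Mapping.single j (int k)) 1" for j k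
    by (induction k) (simp_all add: X_def mult_single flip: single_add)
  have "(\<Prod>j\<in>A. Poly_Mapping.single (f j) (1::rat)) = Poly_Mapping.single (sum f A) 1"
    if "finite A" for A and f :: "nat \<Rightarrow> nat \<Rightarrow>\<^sub>0 int"
    using that by induction (simp_all add: mult_single)
  then show ?thesis
    by (simp add: pow staircase_def of_nat_diff cong: prod.cong)
qed

definition extract_coeff :: "(nat \<Rightarrow>\<^sub>0 int) \<Rightarrow> laurent fps \<Rightarrow> rat fps" where
  "extract_coeff \<mu> F = Abs_fps (\<lambda>n. Poly_Mapping.lookup (fps_nth F n) \<mu>)"

subsection \<open>Power series with Laurent polynomial coefficients\<close>

text \<open>
  The library's division and \<open>fps_exp\<close> need division of coefficients. A series with
  constant term 1 is therefore inverted by \<open>fps_right_inverse\<close>, and the factor \<open>1 / n!\<close> is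
  taken from the rationals.
\<close>

definition recip :: "laurent fps \<Rightarrow> laurent fps" where
  "recip F = fps_right_inverse F 1"

lemma mult_recip: "fps_nth F 0 = 1 \<Longrightarrow> F * recip F = 1"
  unfolding recip_def by (rule fps_right_inverse) simp

definition exp_t :: "laurent \<Rightarrow> laurent fps" where
  "exp_t a = Abs_fps (\<lambda>n. Poly_Mapping.single 0 (1 / fact n) * a ^ n)"

end

theory Submission
  imports Defs
begin

text \<open>
  Both sides count the same walks of \<open>l\<close> particles at distinct sites of \<open>{0, 1, 2, \<dots>}\<close> from
  \<open>{0, \<dots>, l - 1}\<close> back to itself. At each time step one particle moves one site left or right, where
  a left step from \<open>0\<close> leaves the particle at \<open>0\<close>.

  On the algebraic side, the coefficients of \<open>det \<cdot> (\<Sum>x\<^sub>j + \<Sum>1/x\<^sub>j)\<^sup>n\<close> satisfy the recursion of free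
  walks. As a function of the exponent vector they are antisymmetric under exchanging two
  coordinates and symmetric under \<open>y \<mapsto> -1 - y\<close> in one coordinate. So collisions contribute \<open>0\<close>
  and the walls reflect.

  On the combinatorial side, read an involution from its last position to its first and keep the
  tableau obtained by row insertion of the openers of the arcs that cross the current position: a
  closer of an arc inserts its opener, and an opener, being the largest entry, is deleted. The
  columns of the tableau give the positions of the particles. Row insertion is invertible, so the
  number of ways to reach a tableau depends on its shape only. The first row has the length of the
  largest nesting of crossing arcs, and an involution has no descending subsequence of length
  \<open>2l + 1\<close> iff no \<open>l + 1\<close> arcs are nested and no \<open>l\<close> nested arcs enclose a fixed point.
\<close>

subsection \<open>Row insertion on words of row indices\<close>

text \<open>
  A standard tableau with entries in \<open>{1..length u}\<close> is encoded by the word \<open>u\<close>, listed from the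
  largest entry down: the letter for \<open>v\<close> is \<open>Some p\<close> if \<open>v\<close> lies in row \<open>p\<close>, counted from \<open>0\<close>, and
  \<open>None\<close> if \<open>v\<close> is not an entry.
\<close>

definition row_len :: "nat option list \<Rightarrow> nat \<Rightarrow> nat" where
  "row_len u p = count_list u (Some p)"

lemma row_len_simps [simp]:
  "row_len [] p = 0" "row_len (None # u) p = row_len u p"
  "row_len (Some q # u) p = row_len u p + (if p = q then 1 else 0)"
  by (simp_all add: row_len_def)

lemma row_len_replicate [simp]: "row_len (replicate k None) p = 0"
  by (induction k) simp_all

text \<open>The suffixes of the word are the subtableaux of the smaller entries; the condition says
  that all their shapes are partitions.\<close>

fun yamanouchi :: "nat option list \<Rightarrow> bool" where
  "yamanouchi [] \<longleftrightarrow> True"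
| "yamanouchi (None # u) \<longleftrightarrow> yamanouchi u"
| "yamanouchi (Some p # u) \<longleftrightarrow> yamanouchi u \<and> (p = 0 \<or> row_len u p < row_len u (p - 1))"

lemma yamanouchi_replicate [simp]: "yamanouchi (replicate k None)"
  by (induction k) simp_all

lemma yamanouchi_tl: "yamanouchi (x # u) \<Longrightarrow> yamanouchi u"
  by (cases x) auto

lemma yamanouchi_row_len_Suc: "yamanouchi u \<Longrightarrow> row_len u (Suc p) \<le> row_len u p"
proof (induction u)
  case (Cons x u)
  then show ?case
    by (cases x) (auto simp: Suc_le_eq less_Suc_eq_le split: if_splits)
qed simp

lemma yamanouchi_row_len_antimono: "yamanouchi u \<Longrightarrow> p \<le> q \<Longrightarrow> row_len u q \<le> row_len u p"
  by (rule lift_Suc_antimono_le) (auto intro: yamanouchi_row_len_Suc)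

text \<open>
  \<open>insertion a u p v\<close>: row insertion of \<open>a\<close> into \<open>u\<close> gives \<open>v\<close>, with the new box in row \<open>p\<close>. The
  entry bumped out of a row is the next larger one in that row, hence these local rules, which
  scan the entries upwards from \<open>a\<close>.
\<close>
inductive insertion :: "nat \<Rightarrow> nat option list \<Rightarrow> nat \<Rightarrow> nat option list \<Rightarrow> bool" where
  start: "insertion (Suc (length u)) (None # u) 0 (Some 0 # u)"
| pass: "insertion a u p v \<Longrightarrow> x \<noteq> Some p \<Longrightarrow> insertion a (x # u) p (x # v)"
| bump: "insertion a u p v \<Longrightarrow> insertion a (Some p # u) (Suc p) (Some (Suc p) # v)"

lemma insertion_length: "insertion a u p v \<Longrightarrow> length v = length u"
  by (induction rule: insertion.induct) auto

lemma insertion_pos: "insertion a u p v \<Longrightarrow> a \<in> {1..length u}"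
  by (induction rule: insertion.induct) auto

lemma insertion_row_len:
  "insertion a u p v \<Longrightarrow> row_len v q = row_len u q + (if q = p then 1 else 0)"
proof (induction rule: insertion.induct)
  case (pass a u p v x)
  then show ?case by (cases x) auto
qed auto

text \<open>In case \<open>bump\<close>, row \<open>p\<close> of \<open>v\<close> is longer by one
  than row \<open>p\<close> of \<open>u\<close>, hence longer than row \<open>Suc p\<close>, so the
  bumped entry fits there.\<close>

lemma insertion_yamanouchi:
  "insertion a u p v \<Longrightarrow> yamanouchi u \<Longrightarrow>
     yamanouchi v \<and> (p = 0 \<or> row_len u p < row_len u (p - 1))"
proof (induction rule: insertion.induct)
  case (pass a u p v x)
  then show ?case
    by (cases x) (auto simp: insertion_row_len[OF pass.hyps(1)])
next
  case (bump a u p v)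
  then show ?case
    using yamanouchi_row_len_Suc[of u p] by (auto simp: insertion_row_len[OF bump.hyps(1)])
qed simp

lemma insertion_deterministic:
  "insertion a u p v \<Longrightarrow> insertion a u q w \<Longrightarrow> p = q \<and> v = w"
proof (induction arbitrary: q w rule: insertion.induct)
  case (start u)
  from start.prems show ?case
    by cases (use insertion_pos in fastforce)+
next
  case (pass a u p v x)
  from pass.prems show ?case
  proof cases
    case start
    then show ?thesis using insertion_pos[OF pass.hyps(1)] by simp
  qed (use pass.hyps in \<open>auto dest: pass.IH\<close>)
next
  case (bump a u p v)
  from bump.prems show ?case
    by cases (auto dest: bump.IH)
qed

text \<open>Reverse insertion: a top letter of the result other than \<open>Some p\<close> can only
  come from \<open>pass\<close>; the letter \<open>Some p\<close> comes from \<open>start\<close> if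
  \<open>p = 0\<close> and from \<open>bump\<close> otherwise.\<close>

lemma insertion_injective:
  "insertion a u p v \<Longrightarrow> insertion b w p v \<Longrightarrow> a = b \<and> u = w"
proof (induction arbitrary: b w rule: insertion.induct)
  case (start u)
  from start.prems show ?case
    by cases auto
next
  case (pass a u p v x)
  from pass.prems show ?case
    by cases (use pass.hyps in \<open>auto dest: pass.IH\<close>)
next
  case (bump a u p v)
  from bump.prems show ?case
    by cases (auto dest: bump.IH)
qed

text \<open>The hypothesis makes the end of row \<open>p\<close> a removable corner. Reading from
  the largest entry down, the case distinction on the top letter undoes the insertion.\<close>

lemma insertion_surjective:
  "yamanouchi v \<Longrightarrow> row_len v (Suc p) < row_len v p \<Longrightarrow> \<exists>a u. insertion a u p v \<and> yamanouchi u"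
proof (induction v arbitrary: p)
  case (Cons x v)
  have yv: "yamanouchi v" using Cons.prems(1) by (rule yamanouchi_tl)
  show ?case
  proof (cases "x = Some p")
    case True
    show ?thesis
    proof (cases p)
      case 0
      then show ?thesis using True yv start[of v] by fastforce
    next
      case (Suc q)
      have "row_len v (Suc q) < row_len v q" using Cons.prems(1) True Suc by simp
      from Cons.IH[OF yv this] obtain a u where u: "insertion a u q v" "yamanouchi u" by blast
      have "yamanouchi (Some q # u)"
        using u(2) insertion_row_len[OF u(1), of q] insertion_row_len[OF u(1), of "q - 1"]
          yamanouchi_row_len_Suc[OF yv, of "q - 1"]
        by (cases q) auto
      then show ?thesis using bump[OF u(1)] True Suc by blast
    qed
  next
    case False
    have "row_len v (Suc p) < row_len v p"
      using Cons.prems(2) False by (cases x) (auto split: if_splits)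
    from Cons.IH[OF yv this] obtain a u where u: "insertion a u p v" "yamanouchi u" by blast
    have "yamanouchi (x # u)"
    proof (cases x)
      case (Some q)
      then show ?thesis
        using u(2) Cons.prems False insertion_row_len[OF u(1), of q]
          insertion_row_len[OF u(1), of "q - 1"]
        by (cases q) (auto split: if_splits)
    qed (use u(2) in simp)
    then show ?thesis using pass[OF u(1) False] by blast
  qed
qed simp

section \<open>Entries and first row of a tableau\<close>

primrec label :: "nat option list \<Rightarrow> nat \<Rightarrow> nat option" where
  "label [] v = None"
| "label (x # u) v = (if v = Suc (length u) then x else label u v)"

text \<open>The number of entries at most \<open>v\<close> in the first row: the letter
  \<open>x\<close> belongs to the entry \<open>Suc (length u)\<close>, hence the strict
  inequality.\<close>

primrec first_row :: "nat option list \<Rightarrow> nat \<Rightarrow> nat" where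
  "first_row [] v = 0"
| "first_row (x # u) v = first_row u v + (if length u < v \<and> x = Some 0 then 1 else 0)"

lemma label_replicate [simp]: "label (replicate k None) v = None"
  by (induction k) auto

lemma first_row_replicate [simp]: "first_row (replicate k None) v = 0"
  by (induction k) auto

lemma first_row_full: "length u \<le> v \<Longrightarrow> first_row u v = row_len u 0"
proof (induction u)
  case (Cons x u)
  then show ?case by (cases x) auto
qed simp

lemma insertion_label:
  "insertion a u p v \<Longrightarrow> label u a = None \<and> (label v w = None \<longleftrightarrow> w \<noteq> a \<and> label u w = None)"
proof (induction rule: insertion.induct)
  case (start u)
  have "label u (Suc (length u)) = None" for u :: "nat option list"
  proof -
    have "length u < k \<Longrightarrow> label u k = None" for k by (induction u) auto
    then show ?thesis by simp
  qed
  then show ?case by auto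
next
  case (pass a u p v x)
  then show ?case using insertion_pos[OF pass.hyps(1)] insertion_length[OF pass.hyps(1)] by auto
next
  case (bump a u p v)
  then show ?case using insertion_pos[OF bump.hyps] insertion_length[OF bump.hyps] by auto
qed

lemma insertion_first_row_full:
  assumes "insertion a u p v" "length u < w"
  shows "first_row v w = first_row u w + (if p = 0 then 1 else 0)"
  using assms by (simp add: first_row_full insertion_length[OF assms(1)] insertion_row_len[OF assms(1)])

text \<open>In the first row \<open>a\<close> replaces the smallest larger entry, or is appended.
  The count therefore grows by one from \<open>a\<close> up to just before that entry, which is what
  the maximum expresses.\<close>

lemma insertion_first_row:
  "insertion a u p v \<Longrightarrow>
     first_row v w = (if w < a then first_row u w else max (first_row u w) (Suc (first_row u (a - 1))))"
proof (induction arbitrary: w rule: insertion.induct)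
  case (start u)
  show ?case
    using first_row_full[of u w] first_row_full[of u "length u"] by simp
next
  case (pass a u p v x)
  note ins = pass.hyps(1)
  have a: "1 \<le> a" "a \<le> length u" using insertion_pos[OF ins] by auto
  then have row: "first_row (x # u) (a - 1) = first_row u (a - 1)" by auto
  show ?case
  proof (cases "length u < w \<and> x = Some 0")
    case True
    \<comment> \<open>Here \<open>p \<noteq> 0\<close>, so an entry has already left the first row,
      and the count over the whole of \<open>u\<close> is unchanged.\<close>
    then have "first_row v w = first_row u w" "\<not> w < a"
      using insertion_first_row_full[OF ins, of w] pass.hyps(2) a by auto
    moreover have "first_row (x # v) w = Suc (first_row v w)" "first_row (x # u) w = Suc (first_row u w)"
      using True insertion_length[OF ins] by auto
    ultimately show ?thesis
      using pass.IH[of w] row by presburger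
  next
    case False
    then have "first_row (x # v) w = first_row v w" "first_row (x # u) w = first_row u w"
      using insertion_length[OF ins] by auto
    then show ?thesis
      using pass.IH[of w] row by presburger
  qed
next
  case (bump a u p v)
  note ins = bump.hyps(1)
  have a: "1 \<le> a" "a \<le> length u" using insertion_pos[OF ins] by auto
  then have row: "first_row (Some p # u) (a - 1) = first_row u (a - 1)" by auto
  show ?case
  proof (cases "length u < w \<and> p = 0")
    case True
    \<comment> \<open>The box gained by the first row of \<open>v\<close> makes up for the top
      letter, which is bumped out of that row.\<close>
    then have "first_row v w = Suc (first_row u w)" "\<not> w < a"
      using insertion_first_row_full[OF ins, of w] a by auto
    moreover have "first_row (Some (Suc p) # v) w = first_row v w"
      "first_row (Some p # u) w = Suc (first_row u w)"
      using True insertion_length[OF ins] by auto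
    ultimately show ?thesis
      using bump.IH[of w] row by presburger
  next
    case False
    then have "first_row (Some (Suc p) # v) w = first_row v w" "first_row (Some p # u) w = first_row u w"
      using insertion_length[OF ins] by auto
    then show ?thesis
      using bump.IH[of w] row by presburger
  qed
qed

lemma insertion_exists:
  "a \<in> {1..length u} \<Longrightarrow> label u a = None \<Longrightarrow> \<exists>p v. insertion a u p v"
proof (induction u)
  case (Cons x u)
  show ?case
  proof (cases "a = Suc (length u)")
    case True
    then show ?thesis using Cons.prems start[of u] by auto
  next
    case False
    then obtain p v where "insertion a u p v" using Cons by auto
    then show ?thesis using pass bump by metis
  qed
qed simp

subsection \<open>Nestings and the insertion tableaux of an involution\<close>

lemma label_Cons_le [simp]: "v \<le> length u \<Longrightarrow> label (x # u) v = label u v"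
  by simp

lemma first_row_Cons_le [simp]: "v \<le> length u \<Longrightarrow> first_row (x # u) v = first_row u v"
  by simp

text \<open>For \<open>v \<le> i\<close> the list holds the openers, from the outermost inwards, of
  \<open>k\<close> nested arcs that open by \<open>v\<close> and close after \<open>i\<close>. The
  separate bound \<open>v\<close> is what \<open>first_row u v\<close> is compared with.\<close>

definition nesting :: "(nat \<Rightarrow> nat) \<Rightarrow> nat \<Rightarrow> nat \<Rightarrow> nat \<Rightarrow> bool" where
  "nesting \<tau> v i k \<longleftrightarrow> (\<exists>as. length as = k \<and> sorted_wrt (<) as \<and> set as \<subseteq> {1..v} \<and>
     sorted_wrt (>) (map \<tau> as) \<and> (\<forall>a\<in>set as. i < \<tau> a))"

lemma nesting_mono:
  assumes "nesting \<tau> v i k"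
    and "\<And>a. a \<in> {1..v} \<Longrightarrow> i < \<tau> a \<Longrightarrow> a \<in> {1..w} \<and> \<sigma> a = \<tau> a \<and> j < \<tau> a"
  shows "nesting \<sigma> w j k"
proof -
  obtain as where as: "length as = k" "sorted_wrt (<) as" "set as \<subseteq> {1..v}"
      "sorted_wrt (>) (map \<tau> as)" "\<forall>a\<in>set as. i < \<tau> a"
    using assms(1) by (auto simp: nesting_def)
  have *: "a \<in> {1..w} \<and> \<sigma> a = \<tau> a \<and> j < \<tau> a" if "a \<in> set as" for a
    using that as(3,5) assms(2) by blast
  then have "map \<sigma> as = map \<tau> as" by simp
  with as * have "length as = k \<and> sorted_wrt (<) as \<and> set as \<subseteq> {1..w} \<and>
     sorted_wrt (>) (map \<sigma> as) \<and> (\<forall>a\<in>set as. j < \<sigma> a)"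
    by (auto simp del: map_eq_conv)
  then show ?thesis unfolding nesting_def by blast
qed

text \<open>The new arc \<open>(a, i + 1)\<close> ends before all others, so it can only be the innermost arc of a nesting.\<close>
lemma nesting_new_arc:
  assumes inv: "\<And>x. \<tau> (\<tau> x) = x" and fixed: "\<tau> a = a" "\<tau> (Suc i) = Suc i"
    and v: "1 \<le> a" "a \<le> v" "v \<le> i" and \<sigma>: "\<sigma> = \<tau> \<circ> transpose a (Suc i)"
  shows "nesting \<sigma> v i k \<longleftrightarrow>
           nesting \<tau> v (Suc i) k \<or> (\<exists>k'. k = Suc k' \<and> nesting \<tau> (a - 1) (Suc i) k')"
proof -
  have \<sigma>_a: "\<sigma> a = Suc i" using fixed \<sigma> by simp
  have \<sigma>_eq: "\<sigma> x = \<tau> x" if "x \<noteq> a" "x \<noteq> Suc i" for x using that \<sigma> by (simp add: transpose_def)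
  have \<tau>_ne: "\<tau> x \<noteq> Suc i" if "x \<noteq> Suc i" for x using inv fixed(2) that by metis
  show ?thesis
  proof
    assume "nesting \<sigma> v i k"
    then obtain as where as: "length as = k" "sorted_wrt (<) as" "set as \<subseteq> {1..v}"
        "sorted_wrt (>) (map \<sigma> as)" "\<forall>x\<in>set as. i < \<sigma> x"
      by (auto simp: nesting_def)
    have big: "\<sigma> x = \<tau> x \<and> Suc i < \<tau> x" if "x \<in> set as" "x \<noteq> a" for x
      using as(3,5) that v \<sigma>_eq[of x] \<tau>_ne[of x] by fastforce
    show "nesting \<tau> v (Suc i) k \<or> (\<exists>k'. k = Suc k' \<and> nesting \<tau> (a - 1) (Suc i) k')"
    proof (cases "a \<in> set as")
      case False
      with big have "\<forall>x\<in>set as. \<tau> x = \<sigma> x \<and> Suc i < \<tau> x" by metis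
      then have "map \<tau> as = map \<sigma> as" "\<forall>x\<in>set as. Suc i < \<tau> x" by auto
      then show ?thesis using as unfolding nesting_def by metis
    next
      case True
      then obtain bs cs where split: "as = bs @ a # cs" by (auto dest: split_list)
      \<comment> \<open>An opener after \<open>a\<close> would have its closer strictly between
        \<open>i\<close> and \<open>Suc i\<close>.\<close>
      have "cs = []"
      proof (cases cs)
        case (Cons c ds)
        then have "\<sigma> c < Suc i" "i < \<sigma> c" using as(4,5) split \<sigma>_a by (auto simp: sorted_wrt_append)
        then show ?thesis by simp
      qed
      have bs: "\<sigma> x = \<tau> x \<and> Suc i < \<tau> x \<and> x \<in> {1..a - 1}" if "x \<in> set bs" for x
      proof -
        have "x < a" using as(2) split that by (auto simp: sorted_wrt_append)
        moreover have "x \<ge> 1" using as(3) split that by auto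
        ultimately show ?thesis using big[of x] split that by auto
      qed
      then have "map \<tau> bs = map \<sigma> bs" by simp
      then have "nesting \<tau> (a - 1) (Suc i) (length bs)"
        unfolding nesting_def using as(2,4) split bs
        by (intro exI[of _ bs]) (auto simp: sorted_wrt_append simp del: map_eq_conv)
      then show ?thesis using as(1) split \<open>cs = []\<close> by auto
    qed
  next
    assume "nesting \<tau> v (Suc i) k \<or> (\<exists>k'. k = Suc k' \<and> nesting \<tau> (a - 1) (Suc i) k')"
    then show "nesting \<sigma> v i k"
    proof
      assume "nesting \<tau> v (Suc i) k"
      then show ?thesis
      proof (rule nesting_mono)
        fix x assume "x \<in> {1..v}" "Suc i < \<tau> x"
        moreover from this have "x \<noteq> a" using fixed v by auto
        ultimately show "x \<in> {1..v} \<and> \<sigma> x = \<tau> x \<and> i < \<tau> x" using \<sigma>_eq[of x] v by auto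
      qed
    next
      assume "\<exists>k'. k = Suc k' \<and> nesting \<tau> (a - 1) (Suc i) k'"
      then obtain bs where bs: "k = Suc (length bs)" "sorted_wrt (<) bs" "set bs \<subseteq> {1..a - 1}"
          "sorted_wrt (>) (map \<tau> bs)" "\<forall>x\<in>set bs. Suc i < \<tau> x"
        by (auto simp: nesting_def)
      have eq: "\<sigma> x = \<tau> x" if "x \<in> set bs" for x
        by (rule \<sigma>_eq) (use that bs(3) v in auto)
      then have "map \<sigma> bs = map \<tau> bs" by simp
      moreover have "x < a \<and> 1 \<le> x \<and> x \<le> v" if "x \<in> set bs" for x
        using bs(3) that v by fastforce
      ultimately show ?thesis
        unfolding nesting_def using bs v \<sigma>_a eq
        by (intro exI[of _ "bs @ [a]"]) (auto simp: sorted_wrt_append simp del: map_eq_conv)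
    qed
  qed
qed

text \<open>The invariant of the backward reading: the entries of \<open>u\<close> are the openers
  of the arcs crossing \<open>length u\<close>, and Schensted's theorem holds for their nestings. It
  is stated for all \<open>v\<close>, because an insertion of \<open>a\<close> refers to the part of
  the first row below \<open>a\<close>.\<close>

definition coherent :: "nat \<Rightarrow> (nat \<Rightarrow> nat) \<Rightarrow> nat option list \<Rightarrow> bool" where
  "coherent n \<tau> u \<longleftrightarrow> length u \<le> n \<and> \<tau> permutes {1..n} \<and> (\<forall>x. \<tau> (\<tau> x) = x) \<and> yamanouchi u \<and>
     (\<forall>v\<in>{1..length u}. if label u v = None then \<tau> v = v else length u < \<tau> v) \<and>
     (\<forall>v k. v \<le> length u \<longrightarrow> nesting \<tau> v (length u) k \<longleftrightarrow> k \<le> first_row u v)"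

lemma coherent_id: "coherent n id (replicate n None)"
proof -
  have "nesting id v n k \<longleftrightarrow> k = 0" if "v \<le> n" for v k
  proof
    assume "nesting id v n k"
    then obtain as where as: "length as = k" "set as \<subseteq> {1..v}" "\<forall>a\<in>set as. n < a"
      by (auto simp: nesting_def)
    have False if "a \<in> set as" for a using as(2,3) that \<open>v \<le> n\<close> by fastforce
    then have "as = []" using hd_in_set[of as] by blast
    then show "k = 0" using as(1) by simp
  qed (simp add: nesting_def)
  then show ?thesis by (simp add: coherent_def permutes_id)
qed

lemma coherent_top:
  assumes "coherent n \<tau> (x # u)"
  shows "if x = None then \<tau> (Suc (length u)) = Suc (length u) else Suc (length u) < \<tau> (Suc (length u))"
  using assms unfolding coherent_def by (auto dest!: bspec[where x = "Suc (length u)"])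

text \<open>Position \<open>Suc (length u)\<close> is a fixed point or an opener, so no arc ends
  there, and the arcs that open by \<open>length u\<close> and cross it are the same at both
  times.\<close>

lemma coherent_tl:
  assumes "coherent n \<tau> (x # u)"
  shows "coherent n \<tau> u"
proof -
  let ?i = "length u"
  have inv: "\<And>x. \<tau> (\<tau> x) = x" using assms by (simp add: coherent_def)
  have ne: "\<tau> a \<noteq> Suc ?i" if "a \<le> ?i" for a
  proof
    assume "\<tau> a = Suc ?i"
    then have "\<tau> (Suc ?i) = a" using inv by metis
    then show False using coherent_top[OF assms] that by (auto split: if_splits)
  qed
  have "nesting \<tau> v ?i k \<longleftrightarrow> nesting \<tau> v (Suc ?i) k" if "v \<le> ?i" for v k
  proof
    assume "nesting \<tau> v ?i k"
    then show "nesting \<tau> v (Suc ?i) k"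
    proof (rule nesting_mono)
      fix a assume "a \<in> {1..v}" "?i < \<tau> a"
      then show "a \<in> {1..v} \<and> \<tau> a = \<tau> a \<and> Suc ?i < \<tau> a" using ne[of a] that by auto
    qed
  qed (erule nesting_mono, auto)
  then have nest: "\<forall>v k. v \<le> ?i \<longrightarrow> nesting \<tau> v ?i k \<longleftrightarrow> k \<le> first_row u v"
    using assms by (simp add: coherent_def)
  have lab: "\<forall>v\<in>{1..?i}. if label u v = None then \<tau> v = v else ?i < \<tau> v"
  proof
    fix v assume v: "v \<in> {1..?i}"
    then have "v \<in> {1..length (x # u)}" "label (x # u) v = label u v" by auto
    then have "if label u v = None then \<tau> v = v else length (x # u) < \<tau> v"
      using assms unfolding coherent_def by metis
    then show "if label u v = None then \<tau> v = v else ?i < \<tau> v" by (auto split: if_splits)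
  qed
  show ?thesis
    using assms nest lab unfolding coherent_def by (auto dest: yamanouchi_tl)
qed

lemma comp_transpose_permutes:
  assumes "\<tau> permutes {1..n}" "a \<in> {1..n}" "b \<in> {1..n}"
  shows "\<tau> \<circ> transpose a b permutes {1..n}"
  using assms by (intro permutes_compose permutes_swap_id)

lemma comp_transpose_involution:
  fixes \<tau> :: "nat \<Rightarrow> nat"
  assumes "\<And>x. \<tau> (\<tau> x) = x" "\<tau> a = a" "\<tau> b = b"
  shows "(\<tau> \<circ> transpose a b) ((\<tau> \<circ> transpose a b) x) = x"
proof -
  have "\<tau> y = a \<longleftrightarrow> y = a" "\<tau> y = b \<longleftrightarrow> y = b" for y using assms by metis+
  then show ?thesis using assms by (auto simp: transpose_def)
qed

text \<open>The recursion of nestings in \<open>nesting_new_arc\<close> and that of first rows in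
  \<open>insertion_first_row\<close> are the same: for bounds below \<open>a\<close> nothing
  changes, and from \<open>a\<close> on a nesting may end with the new arc.\<close>

lemma coherent_insertion:
  assumes "coherent n \<tau> (None # u)" and ins: "insertion a u p v"
  shows "coherent n (\<tau> \<circ> transpose a (Suc (length u))) v"
proof -
  let ?i = "length u" and ?\<sigma> = "\<tau> \<circ> transpose a (Suc (length u))"
  have len: "length v = ?i" using insertion_length[OF ins] .
  have a: "1 \<le> a" "a \<le> ?i" using insertion_pos[OF ins] by auto
  have inv: "\<And>x. \<tau> (\<tau> x) = x" and n: "Suc ?i \<le> n" and perm: "\<tau> permutes {1..n}"
    and yam: "yamanouchi u"
    and nest: "\<And>w k. w \<le> ?i \<Longrightarrow> nesting \<tau> w (Suc ?i) k \<longleftrightarrow> k \<le> first_row u w"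
    using assms by (auto simp: coherent_def)
  have lab: "if label u w = None then \<tau> w = w else Suc ?i < \<tau> w" if "w \<in> {1..?i}" for w
  proof -
    have "w \<in> {1..length (None # u)}" "label (None # u) w = label u w" using that by auto
    then show ?thesis using assms(1) unfolding coherent_def by (metis length_Cons)
  qed
  have fixed: "\<tau> a = a" "\<tau> (Suc ?i) = Suc ?i"
    using lab[of a] insertion_label[OF ins] a coherent_top[OF assms(1)] by auto
  have \<sigma>_eq: "?\<sigma> x = \<tau> x" if "x \<noteq> a" "x \<noteq> Suc ?i" for x using that by (simp add: transpose_def)
  have nest_v: "nesting ?\<sigma> w ?i k \<longleftrightarrow> k \<le> first_row v w" if w: "w \<le> ?i" for w k
  proof (cases "w < a")
    case True
    have "nesting ?\<sigma> w ?i k \<longleftrightarrow> nesting \<tau> w (Suc ?i) k"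
    proof
      assume "nesting ?\<sigma> w ?i k"
      then show "nesting \<tau> w (Suc ?i) k"
      proof (rule nesting_mono)
        fix x assume x: "x \<in> {1..w}" "?i < ?\<sigma> x"
        then have "?\<sigma> x = \<tau> x" using True w by (intro \<sigma>_eq) auto
        moreover have "\<tau> x \<noteq> Suc ?i" using inv[of x] fixed(2) x w by auto
        ultimately show "x \<in> {1..w} \<and> \<tau> x = ?\<sigma> x \<and> Suc ?i < ?\<sigma> x" using x by auto
      qed
    next
      assume "nesting \<tau> w (Suc ?i) k"
      then show "nesting ?\<sigma> w ?i k"
      proof (rule nesting_mono)
        fix x assume x: "x \<in> {1..w}" "Suc ?i < \<tau> x"
        then have "?\<sigma> x = \<tau> x" using True w by (intro \<sigma>_eq) auto
        then show "x \<in> {1..w} \<and> ?\<sigma> x = \<tau> x \<and> ?i < \<tau> x" using x by auto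
      qed
    qed
    then show ?thesis using nest[OF w] insertion_first_row[OF ins, of w] True by simp
  next
    case False
    then have "nesting ?\<sigma> w ?i k \<longleftrightarrow>
        nesting \<tau> w (Suc ?i) k \<or> (\<exists>k'. k = Suc k' \<and> nesting \<tau> (a - 1) (Suc ?i) k')"
      using inv fixed a w by (intro nesting_new_arc) auto
    also have "\<dots> \<longleftrightarrow> k \<le> first_row u w \<or> (\<exists>k'. k = Suc k' \<and> k' \<le> first_row u (a - 1))"
      using nest[OF w] nest[of "a - 1"] a by auto
    also have "\<dots> \<longleftrightarrow> k \<le> max (first_row u w) (Suc (first_row u (a - 1)))"
      by (cases k) auto
    finally show ?thesis using insertion_first_row[OF ins, of w] False by simp
  qed
  have lab_v: "if label v w = None then ?\<sigma> w = w else ?i < ?\<sigma> w" if "w \<in> {1..?i}" for w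
  proof (cases "w = a")
    case True
    then show ?thesis using insertion_label[OF ins, of w] fixed by auto
  next
    case False
    then show ?thesis
      using insertion_label[OF ins, of w] lab[OF that] that \<sigma>_eq[of w] by (auto split: if_splits)
  qed
  have "?\<sigma> permutes {1..n}"
    by (rule comp_transpose_permutes) (use perm a n in auto)
  then show ?thesis
    unfolding coherent_def len
    using n nest_v lab_v comp_transpose_involution[OF inv fixed] insertion_yamanouchi[OF ins yam]
    by (auto simp del: comp_apply)
qed

text \<open>
  \<open>growth l n \<tau> u\<close> concerns the time \<open>i = length u\<close> of reading backwards: \<open>\<tau>\<close> has only the arcs that
  end after \<open>i\<close>, and \<open>u\<close> is the insertion tableau of their openers \<open>\<le> i\<close>. The bounds on the first
  row express that descending subsequences have length at most \<open>2l\<close>.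
\<close>
inductive growth :: "nat \<Rightarrow> nat \<Rightarrow> (nat \<Rightarrow> nat) \<Rightarrow> nat option list \<Rightarrow> bool" for l n where
  empty: "growth l n id (replicate n None)"
| opener: "growth l n \<tau> (Some p # u) \<Longrightarrow> growth l n \<tau> u"
| fixpoint: "growth l n \<tau> (None # u) \<Longrightarrow> row_len u 0 < l \<Longrightarrow> growth l n \<tau> u"
| closer: "growth l n \<tau> (None # u) \<Longrightarrow> insertion a u p v \<Longrightarrow> row_len v 0 \<le> l \<Longrightarrow>
    growth l n (\<tau> \<circ> transpose a (Suc (length u))) v"

lemma growth_coherent: "growth l n \<tau> u \<Longrightarrow> coherent n \<tau> u"
proof (induction rule: growth.induct)
  case empty
  show ?case by (rule coherent_id)
next
  case closer
  then show ?case by (intro coherent_insertion)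
qed (simp_all add: coherent_tl)

lemma growth_row_len: "growth l n \<tau> u \<Longrightarrow> row_len u 0 \<le> l"
  by (induction rule: growth.induct) (auto split: if_splits)

lemma growth_length: "growth l n \<tau> u \<Longrightarrow> length u \<le> n"
  using growth_coherent by (auto simp: coherent_def)

lemma closer_apply:
  assumes "growth l n \<tau> (None # u)" "insertion a u p v"
  shows "\<tau> a = a" "\<tau> (Suc (length u)) = Suc (length u)"
    "(\<tau> \<circ> transpose a (Suc (length u))) (Suc (length u)) = a"
proof -
  have coh: "coherent n \<tau> (None # u)" using assms(1) by (rule growth_coherent)
  show "\<tau> (Suc (length u)) = Suc (length u)" using coherent_top[OF coh] by simp
  have "a \<in> {1..length u}" using insertion_pos[OF assms(2)] .
  then show "\<tau> a = a"
    using coherent_tl[OF coh] insertion_label[OF assms(2)] unfolding coherent_def by metis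
  then show "(\<tau> \<circ> transpose a (Suc (length u))) (Suc (length u)) = a" by simp
qed

text \<open>Comparing \<open>\<tau> (Suc (length u))\<close> with \<open>Suc (length u)\<close>
  tells which rule was applied last, and for a closer the value is \<open>a\<close>.\<close>

lemma growth_cases_length:
  assumes "growth l n \<tau> u" "length u < n"
  obtains (opener) p where "growth l n \<tau> (Some p # u)" "Suc (length u) < \<tau> (Suc (length u))"
  | (fixpoint) "growth l n \<tau> (None # u)" "row_len u 0 < l" "\<tau> (Suc (length u)) = Suc (length u)"
  | (closer) \<sigma> a p v where "growth l n \<sigma> (None # v)" "insertion a v p u" "row_len u 0 \<le> l"
      "length v = length u" "\<tau> = \<sigma> \<circ> transpose a (Suc (length u))" "\<tau> (Suc (length u)) = a"
      "a \<le> length u"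
  using assms(1)
proof cases
  case empty
  then show ?thesis using assms(2) by simp
next
  case (opener p)
  then show ?thesis using that(1) coherent_top[OF growth_coherent[OF opener]] by simp
next
  case fixpoint
  then show ?thesis using that(2) coherent_top[OF growth_coherent[OF fixpoint(1)]] by simp
next
  case (closer \<sigma> v a p)
  then show ?thesis
    using that(3) closer_apply(3)[OF closer(2,3)] insertion_length[OF closer(3)]
      insertion_pos[OF closer(3)] by simp
qed

text \<open>\<open>\<tau>\<close> determines its tableau at each time. Its value at
  \<open>Suc (length u)\<close> gives the last rule; for a closer, composing with the transposition
  again recovers the previous involution.\<close>

lemma growth_unique:
  "growth l n \<tau> u \<Longrightarrow> growth l n \<tau> v \<Longrightarrow> length u = length v \<Longrightarrow> u = v"
proof (induction "n - length u" arbitrary: \<tau> u v)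
  case 0
  \<comment> \<open>At length \<open>n\<close> only \<open>empty\<close> applies: the other rules
    start from a word of length \<open>n + 1\<close>.\<close>
  have full: "w = replicate n None" if "growth l n \<tau> w" "length w = n" for w
    using that(1)
  proof cases
    case empty
    then show ?thesis by simp
  next
    case (opener p)
    then show ?thesis using growth_length[OF opener] that(2) by simp
  next
    case fixpoint
    then show ?thesis using growth_length[OF fixpoint(1)] that(2) by simp
  next
    case (closer \<sigma> w' a p)
    then show ?thesis
      using growth_length[OF closer(2)] insertion_length[OF closer(3)] that(2) by simp
  qed
  have "length u = n" using 0 growth_length[OF 0(2)] by simp
  then show ?case using full[OF 0(2)] full[OF 0(3)] 0(4) by simp
next
  case (Suc m)
  let ?i = "length u"
  have less: "?i < n" "length v < n" using Suc.hyps(2) Suc.prems(3) by auto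
  from Suc.prems(1) less(1) show ?case
  proof (cases rule: growth_cases_length)
    case (opener p)
    from Suc.prems(2) less(2) show ?thesis
    proof (cases rule: growth_cases_length)
      case (opener q)
      have "Some p # u = Some q # v"
        by (rule Suc.hyps(1)) (use opener \<open>growth l n \<tau> (Some p # u)\<close> Suc in auto)
      then show ?thesis by simp
    qed (use opener Suc.prems(3) in auto)
  next
    case fixpoint
    from Suc.prems(2) less(2) show ?thesis
    proof (cases rule: growth_cases_length)
      case fixpoint
      have "None # u = None # v"
        by (rule Suc.hyps(1)) (use fixpoint \<open>growth l n \<tau> (None # u)\<close> Suc in auto)
      then show ?thesis by simp
    qed (use fixpoint Suc.prems(3) in auto)
  next
    case closer1: (closer \<sigma> a p w)
    from Suc.prems(2) less(2) show ?thesis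
    proof (cases rule: growth_cases_length)
      case closer2: (closer \<sigma>' b q w')
      have ab: "a = b" using closer1 closer2 Suc.prems(3) by simp
      have "\<sigma> \<circ> transpose a (Suc ?i) = \<sigma>' \<circ> transpose a (Suc ?i)"
        using closer1 closer2 ab Suc.prems(3) by simp
      then have "\<sigma> = \<sigma>'" by (metis comp_assoc comp_id transpose_comp_involutory)
      have "None # w = None # w'"
      proof (rule Suc.hyps(1))
        show "m = n - length (None # w)" using Suc.hyps(2) closer1(4) by simp
        show "growth l n \<sigma> (None # w)" using closer1(1) .
        show "growth l n \<sigma> (None # w')" using closer2(1) \<open>\<sigma> = \<sigma>'\<close> by simp
        show "length (None # w) = length (None # w')"
          using closer1(4) closer2(4) Suc.prems(3) by simp
      qed
      then show ?thesis using insertion_deterministic closer1(2) closer2(2) ab by blast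
    qed (use closer1 Suc.prems(3) in auto)
  qed
qed

subsection \<open>Descending subsequences\<close>

text \<open>The conditions that \<open>growth\<close> imposes from time \<open>n\<close> down to
  \<open>i\<close>, expressed without tableaux. In the second one \<open>j\<close> is fixed, so the
  nested arcs enclose it.\<close>

definition nesting_bounded :: "nat \<Rightarrow> nat \<Rightarrow> (nat \<Rightarrow> nat) \<Rightarrow> nat \<Rightarrow> bool" where
  "nesting_bounded l n \<tau> i \<longleftrightarrow>
     (\<forall>j\<in>{i..n}. \<not> nesting \<tau> j j (Suc l)) \<and> (\<forall>j\<in>{i<..n}. \<tau> j = j \<longrightarrow> \<not> nesting \<tau> j j l)"

lemma nesting_comp_transpose:
  assumes "\<tau> a = a" "\<tau> b = b" "a \<le> j" "b \<le> j"
  shows "nesting (\<tau> \<circ> transpose a b) j j k \<longleftrightarrow> nesting \<tau> j j k"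
proof -
  let ?\<sigma> = "\<tau> \<circ> transpose a b"
  have *: "?\<sigma> x = \<tau> x" if "j < \<tau> x \<or> j < ?\<sigma> x" for x
    using assms that by (cases "x = a"; cases "x = b") (auto simp: transpose_def)
  show ?thesis
    by (rule iffI; erule nesting_mono) (metis * order_refl)+
qed

lemma nesting_bounded_closer:
  assumes "\<tau> a = a" "\<tau> (Suc i) = Suc i" "a \<le> i"
  shows "nesting_bounded l n (\<tau> \<circ> transpose a (Suc i)) (Suc i) \<longleftrightarrow> nesting_bounded l n \<tau> (Suc i)"
proof -
  have "nesting (\<tau> \<circ> transpose a (Suc i)) j j k \<longleftrightarrow> nesting \<tau> j j k" if "Suc i \<le> j" for j k
    using that assms by (intro nesting_comp_transpose) auto
  moreover have "(\<tau> \<circ> transpose a (Suc i)) j = \<tau> j" if "Suc i < j" for j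
    using that assms by (simp add: transpose_def)
  ultimately show ?thesis unfolding nesting_bounded_def by auto
qed

lemma coherent_nesting:
  "coherent n \<tau> u \<Longrightarrow> nesting \<tau> (length u) (length u) k \<longleftrightarrow> k \<le> row_len u 0"
  using first_row_full[of u "length u"] by (simp add: coherent_def)

lemma coherent_nesting_Suc:
  assumes "coherent n \<tau> (None # u)"
  shows "nesting \<tau> (Suc (length u)) (Suc (length u)) k \<longleftrightarrow> k \<le> row_len u 0"
  using coherent_nesting[OF assms] by simp

lemma nesting_bounded_Suc_iff:
  assumes "i < n"
  shows "nesting_bounded l n \<tau> i \<longleftrightarrow> nesting_bounded l n \<tau> (Suc i) \<and> \<not> nesting \<tau> i i (Suc l) \<and>
    (\<tau> (Suc i) = Suc i \<longrightarrow> \<not> nesting \<tau> (Suc i) (Suc i) l)"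
proof -
  have "{i..n} = insert i {Suc i..n}" "{i<..n} = insert (Suc i) {Suc i<..n}"
    using assms by auto
  then show ?thesis unfolding nesting_bounded_def by auto
qed

lemma growth_nesting_bounded: "growth l n \<tau> u \<Longrightarrow> nesting_bounded l n \<tau> (length u)"
proof (induction rule: growth.induct)
  case empty
  show ?case using coherent_nesting[OF coherent_id, of n] by (simp add: nesting_bounded_def id_def)
next
  case (opener \<tau> p u)
  note g = growth.opener[OF opener.hyps]
  have "length u < n" using growth_length[OF opener.hyps] by simp
  moreover have "\<not> nesting \<tau> (length u) (length u) (Suc l)"
    using coherent_nesting[OF growth_coherent[OF g]] growth_row_len[OF g] by simp
  ultimately show ?case
    using opener.IH coherent_top[OF growth_coherent[OF opener.hyps]]
    by (simp add: nesting_bounded_Suc_iff)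
next
  case (fixpoint \<tau> u)
  note g = growth.fixpoint[OF fixpoint.hyps]
  have "length u < n" using growth_length[OF fixpoint.hyps(1)] by simp
  moreover have "\<not> nesting \<tau> (length u) (length u) (Suc l)"
    using coherent_nesting[OF growth_coherent[OF g]] growth_row_len[OF g] by simp
  ultimately show ?case
    using fixpoint.IH fixpoint.hyps(2) coherent_nesting_Suc[OF growth_coherent[OF fixpoint.hyps(1)]]
    by (simp add: nesting_bounded_Suc_iff)
next
  case (closer \<tau> u a p v)
  note g = growth.closer[OF closer.hyps]
  have len: "length v = length u" using insertion_length[OF closer.hyps(2)] .
  have "length u < n" using growth_length[OF closer.hyps(1)] by simp
  moreover have "\<not> nesting (\<tau> \<circ> transpose a (Suc (length u))) (length u) (length u) (Suc l)"
    using coherent_nesting[OF growth_coherent[OF g]] growth_row_len[OF g] len by simp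
  moreover have "(\<tau> \<circ> transpose a (Suc (length u))) (Suc (length u)) \<noteq> Suc (length u)"
    using closer_apply(3)[OF closer.hyps(1,2)] insertion_pos[OF closer.hyps(2)] by simp
  moreover have "nesting_bounded l n (\<tau> \<circ> transpose a (Suc (length u))) (Suc (length u))"
    using nesting_bounded_closer[OF closer_apply(1,2)[OF closer.hyps(1,2)]]
      insertion_pos[OF closer.hyps(2)] closer.IH by simp
  ultimately show ?case
    by (simp add: nesting_bounded_Suc_iff len del: comp_apply)
qed

text \<open>The converse of \<open>growth_nesting_bounded\<close>. The induction goes from
  \<open>n\<close> down to \<open>i\<close>; the fourth hypothesis says that no arc of
  \<open>\<tau>\<close> ends by \<open>i\<close>.\<close>

lemma growth_exists:
  assumes "i \<le> n" "\<tau> permutes {1..n}" "\<And>x. \<tau> (\<tau> x) = x"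
    and "\<And>a. a \<in> {1..i} \<Longrightarrow> \<tau> a = a \<or> i < \<tau> a" and "nesting_bounded l n \<tau> i"
  shows "\<exists>u. length u = i \<and> growth l n \<tau> u"
  using assms
proof (induction "n - i" arbitrary: i \<tau>)
  case 0
  have "\<tau> x = x" for x
  proof (cases "x \<in> {1..n}")
    case True
    then show ?thesis using 0 permutes_in_image[OF 0(3), of x] by force
  next
    case False
    then show ?thesis using permutes_not_in[OF 0(3)] by blast
  qed
  then have "\<tau> = id" by auto
  moreover have "i = n" using 0 by simp
  ultimately show ?case
    using growth.empty[of l n] by (intro exI[of _ "replicate n None"]) (simp add: id_def)
next
  case (Suc m)
  have i: "i < n" "m = n - Suc i" using Suc.hyps(2) by auto
  have bounded: "nesting_bounded l n \<tau> (Suc i)" "\<not> nesting \<tau> i i (Suc l)"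
      "\<tau> (Suc i) = Suc i \<Longrightarrow> \<not> nesting \<tau> (Suc i) (Suc i) l"
    using Suc.prems(5) i(1) by (auto simp: nesting_bounded_Suc_iff)
  have step: "\<exists>x u. length u = i \<and> growth l n \<sigma> (x # u)"
    if "\<sigma> permutes {1..n}" "\<And>x. \<sigma> (\<sigma> x) = x"
      "\<And>a. a \<in> {1..Suc i} \<Longrightarrow> \<sigma> a = a \<or> Suc i < \<sigma> a" "nesting_bounded l n \<sigma> (Suc i)" for \<sigma>
  proof -
    from Suc.hyps(1)[OF i(2), of \<sigma>] that i(1) obtain w where "length w = Suc i" "growth l n \<sigma> w"
      by force
    then show ?thesis by (cases w) auto
  qed
  show ?case
  proof (cases "Suc i \<le> \<tau> (Suc i)")
    case True
    have "\<tau> a = a \<or> Suc i < \<tau> a" if "a \<in> {1..Suc i}" for a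
    proof (cases "a = Suc i")
      case False
      then have "\<tau> a = a \<or> i < \<tau> a" using Suc.prems(4)[of a] that by auto
      moreover have "\<tau> a \<noteq> Suc i" using Suc.prems(3)[of a] True that False by auto
      ultimately show ?thesis by auto
    qed (use True in auto)
    then obtain x u where u: "length u = i" "growth l n \<tau> (x # u)"
      using step[of \<tau>] Suc.prems bounded(1) by auto
    note coh = growth_coherent[OF u(2)]
    show ?thesis
    proof (cases x)
      case None
      then have "\<tau> (Suc i) = Suc i" using coherent_top[OF coh] u(1) by simp
      then have "row_len u 0 < l"
        using bounded(3) coherent_nesting_Suc[of n \<tau> u l] coh None u(1) by simp
      then show ?thesis using growth.fixpoint[of l n \<tau> u] u None by auto
    next
      case (Some p)
      then show ?thesis using growth.opener[of l n \<tau> p u] u by auto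
    qed
  next
    case False
    \<comment> \<open>\<open>Suc i\<close> closes the arc \<open>(a, Suc i)\<close>. Removing this
      arc gives the involution of the previous time, and inserting \<open>a\<close> puts it
      back.\<close>
    define a where "a = \<tau> (Suc i)"
    let ?\<sigma> = "\<tau> \<circ> transpose a (Suc i)"
    have a: "a \<in> {1..i}"
      using False permutes_in_image[OF Suc.prems(2), of "Suc i"] i(1) by (auto simp: a_def)
    have \<tau>_a: "\<tau> a = Suc i" using Suc.prems(3) by (simp add: a_def)
    have fixed: "?\<sigma> a = a" "?\<sigma> (Suc i) = Suc i" using \<tau>_a by (simp_all add: a_def)
    have \<sigma>_eq: "?\<sigma> x = \<tau> x" if "x \<noteq> a" "x \<noteq> Suc i" for x using that by (simp add: transpose_def)
    have \<tau>_eq: "?\<sigma> \<circ> transpose a (Suc i) = \<tau>" by (simp add: comp_assoc)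
    have perm: "?\<sigma> permutes {1..n}"
      by (rule comp_transpose_permutes) (use Suc.prems(2) a i(1) in auto)
    have inv: "?\<sigma> (?\<sigma> x) = x" for x
    proof (cases "x = a \<or> x = Suc i")
      case True
      then show ?thesis using fixed by metis
    next
      case False
      then have "\<tau> x \<noteq> a" "\<tau> x \<noteq> Suc i" using Suc.prems(3) \<tau>_a a_def by metis+
      then show ?thesis using False \<sigma>_eq Suc.prems(3) by metis
    qed
    have "?\<sigma> x = x \<or> Suc i < ?\<sigma> x" if "x \<in> {1..Suc i}" for x
    proof (cases "x = a \<or> x = Suc i")
      case True
      then show ?thesis using fixed by metis
    next
      case False
      then have "\<tau> x \<noteq> Suc i" using Suc.prems(3) a_def by metis
      then show ?thesis using Suc.prems(4)[of x] \<sigma>_eq[of x] False that by auto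
    qed
    moreover have "nesting_bounded l n ?\<sigma> (Suc i)"
      using nesting_bounded_closer[of ?\<sigma> a i l n] fixed a bounded(1) \<tau>_eq by simp
    ultimately obtain x u where u: "length u = i" "growth l n ?\<sigma> (x # u)"
      using step[of ?\<sigma>] perm inv by blast
    note coh = growth_coherent[OF u(2)]
    have x: "x = None" using coherent_top[OF coh] fixed(2) u(1) by (auto split: if_splits)
    have "label u a = None"
      using coherent_tl[OF coh] fixed(1) a u(1) unfolding coherent_def
      by (metis atLeastAtMost_iff leD)
    then obtain p v where ins: "insertion a u p v"
      using insertion_exists[of a u] a u(1) by blast
    have "coherent n \<tau> v" using coherent_insertion[OF _ ins, of n ?\<sigma>] coh x u(1) \<tau>_eq by simp
    then have "row_len v 0 \<le> l"
      using bounded(2) coherent_nesting[of n \<tau> v "Suc l"] insertion_length[OF ins] u(1) by simp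
    then have "growth l n \<tau> v" using growth.closer[of l n ?\<sigma> u a p v] u x ins \<tau>_eq by simp
    then show ?thesis using insertion_length[OF ins] u(1) by blast
  qed
qed

text \<open>The last element \<open>j\<close> is the largest opener and has the smallest closer, so
  all the arcs cross \<open>j\<close>.\<close>

lemma excedance_nesting:
  assumes "\<And>x. \<tau> (\<tau> x) = x" "sorted_wrt (<) as" "sorted_wrt (>) (map \<tau> as)"
    "set as \<subseteq> {1..n}" "\<forall>a\<in>set as. a < \<tau> a" "as \<noteq> []"
  shows "\<exists>j\<in>{1..n}. nesting \<tau> j j (length as)"
proof -
  define j where "j = last as"
  have j: "j \<in> set as" using assms(6) by (simp add: j_def)
  have as: "as = butlast as @ [j]" using assms(6) by (simp add: j_def)
  have "a \<le> j \<and> \<tau> j \<le> \<tau> a" if "a \<in> set as" for a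
  proof (cases "a = j")
    case False
    have "a \<in> set (butlast as @ [j])" using that as by simp
    with False have "a \<in> set (butlast as)" by simp
    moreover have "sorted_wrt (<) (butlast as @ [j])" "sorted_wrt (>) (map \<tau> (butlast as @ [j]))"
      using assms(2,3) as by metis+
    ultimately show ?thesis by (auto simp: sorted_wrt_append)
  qed simp
  then have "nesting \<tau> j j (length as)"
    unfolding nesting_def using assms j by (intro exI[of _ as]) fastforce
  then show ?thesis using j assms(4) by blast
qed

text \<open>The openers are followed by their closers in reverse order. \<open>\<tau>\<close>
  reverses this list, so the \<open>2 * k\<close> values descend.\<close>

lemma nesting_descending:
  assumes inv: "\<And>x. \<tau> (\<tau> x) = x" and perm: "\<tau> permutes {1..n}"
    and nest: "nesting \<tau> j j k" and "j \<le> n"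
  obtains as where "length as = k" "sorted_wrt (<) (as @ rev (map \<tau> as))"
    "sorted_wrt (>) (map \<tau> (as @ rev (map \<tau> as)))" "set (as @ rev (map \<tau> as)) \<subseteq> {1..n}"
    "\<forall>a\<in>set as. a \<le> j \<and> j < \<tau> a"
proof -
  obtain as where as: "length as = k" "sorted_wrt (<) as" "set as \<subseteq> {1..j}"
      "sorted_wrt (>) (map \<tau> as)" "\<forall>a\<in>set as. j < \<tau> a"
    using nest by (auto simp: nesting_def)
  have le: "\<forall>a\<in>set as. a \<le> j" "\<forall>a\<in>set as. a \<in> {1..n}" using as(3) \<open>j \<le> n\<close> by auto
  have "map \<tau> (rev (map \<tau> as)) = rev as" by (simp add: rev_map inv comp_def)
  then have map: "map \<tau> (as @ rev (map \<tau> as)) = map \<tau> as @ rev as" by simp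
  have lt: "b < \<tau> a" if "a \<in> set as" "b \<in> set as" for a b
    using le(1) as(5) that le_less_trans by blast
  then have 1: "sorted_wrt (<) (as @ rev (map \<tau> as))"
    unfolding sorted_wrt_append sorted_wrt_rev using as(2,4) by simp
  from lt have 2: "sorted_wrt (>) (map \<tau> (as @ rev (map \<tau> as)))"
    unfolding map sorted_wrt_append using as(2,4) by (simp add: sorted_wrt_rev)
  have 3: "set (as @ rev (map \<tau> as)) \<subseteq> {1..n}"
    using le permutes_in_image[OF perm] by auto
  show ?thesis using that as(1) 1 2 3 le as(5) by blast
qed

text \<open>A descending subsequence consists of excedances, at most one fixed point, and
  deficiencies, which \<open>\<tau>\<close> turns into excedances. There are at most
  \<open>l\<close> of either, so length \<open>2 * l + 1\<close> forces \<open>l\<close> nested arcs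
  around a fixed point. Conversely, such arcs or \<open>l + 1\<close> nested arcs yield a descending
  subsequence.\<close>

lemma nesting_bounded_iff_no_descending:
  assumes inv: "\<And>x. \<tau> (\<tau> x) = x" and perm: "\<tau> permutes {1..n}"
  shows "nesting_bounded l n \<tau> 0 \<longleftrightarrow> \<not> has_descending_subseq (2 * l + 1) (n, \<tau>)"
proof
  assume bounded: "nesting_bounded l n \<tau> 0"
  have exc: "length as \<le> l"
    if "sorted_wrt (<) as" "sorted_wrt (>) (map \<tau> as)" "set as \<subseteq> {1..n}" "\<forall>a\<in>set as. a < \<tau> a" for as
  proof (rule ccontr)
    assume "\<not> length as \<le> l"
    then have len: "length (take (Suc l) as) = Suc l" by simp
    have "\<exists>j\<in>{1..n}. nesting \<tau> j j (length (take (Suc l) as))"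
    proof (rule excedance_nesting[OF inv])
      show "sorted_wrt (<) (take (Suc l) as)" using that(1) by (rule sorted_wrt_take)
      show "sorted_wrt (>) (map \<tau> (take (Suc l) as))"
        using sorted_wrt_take[OF that(2)] by (simp add: take_map)
      show "set (take (Suc l) as) \<subseteq> {1..n}" "\<forall>a\<in>set (take (Suc l) as). a < \<tau> a"
        using that(3,4) by (auto dest: in_set_takeD)
      show "take (Suc l) as \<noteq> []" using len by auto
    qed
    then show False using bounded len unfolding nesting_bounded_def by auto
  qed
  show "\<not> has_descending_subseq (2 * l + 1) (n, \<tau>)"
  proof
    assume "has_descending_subseq (2 * l + 1) (n, \<tau>)"
    then obtain xs where xs: "length xs = 2 * l + 1" "set xs \<subseteq> {1..n}" "sorted_wrt (<) xs"
        "sorted_wrt (>) (map \<tau> xs)"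
      by (auto simp: has_descending_subseq_def)
    define es where "es = filter (\<lambda>x. x < \<tau> x) xs"
    define fs where "fs = filter (\<lambda>x. \<tau> x = x) xs"
    define ds where "ds = filter (\<lambda>x. \<tau> x < x) xs"
    have sorted: "sorted_wrt (<) (filter P xs)" "sorted_wrt (>) (map \<tau> (filter P xs))" for P
      using xs(3,4) by (simp_all add: sorted_wrt_filter sorted_wrt_map)
    have len: "length xs = length es + length fs + length ds"
      unfolding es_def fs_def ds_def by (induction xs) auto
    have es: "length es \<le> l"
      unfolding es_def by (rule exc) (use sorted xs(2) in auto)
    have "length (rev (map \<tau> ds)) \<le> l"
    proof (rule exc)
      have "map \<tau> (rev (map \<tau> ds)) = rev ds" by (simp add: rev_map inv comp_def)
      then show "sorted_wrt (>) (map \<tau> (rev (map \<tau> ds)))"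
        using sorted unfolding ds_def by (simp add: sorted_wrt_rev)
      show "sorted_wrt (<) (rev (map \<tau> ds))" using sorted unfolding ds_def by (simp add: sorted_wrt_rev)
      have "x \<in> {1..n} \<and> \<tau> x < x" if "x \<in> set ds" for x using that xs(2) by (auto simp: ds_def)
      then show "set (rev (map \<tau> ds)) \<subseteq> {1..n}" "\<forall>a\<in>set (rev (map \<tau> ds)). a < \<tau> a"
        using permutes_in_image[OF perm] inv by auto
    qed
    then have ds: "length ds \<le> l" by simp
    have "length fs \<le> 1"
    proof (cases fs)
      case (Cons f gs)
      have "gs = []"
      proof (cases gs)
        case (Cons g hs)
        then have "f \<in> set fs" "g \<in> set fs" using \<open>fs = f # gs\<close> by auto
        then have "\<tau> f = f" "\<tau> g = g" by (auto simp: fs_def)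
        moreover have "f < g" "\<tau> g < \<tau> f"
          using sorted[of "\<lambda>x. \<tau> x = x"] \<open>fs = f # gs\<close> Cons unfolding fs_def by auto
        ultimately show ?thesis by simp
      qed
      then show ?thesis using Cons by simp
    qed simp
    then have "length es = l" "length fs = 1" using len xs(1) es ds by auto
    then obtain f where f: "fs = [f]" by (auto simp: length_Suc_conv)
    have "f \<in> set fs" using f by simp
    then have f_xs: "f \<in> set xs" "\<tau> f = f" by (auto simp: fs_def)
    have "nesting \<tau> f f l"
      unfolding nesting_def
    proof (intro exI[of _ es] conjI ballI subsetI)
      show "sorted_wrt (<) es" "sorted_wrt (>) (map \<tau> es)" using sorted unfolding es_def by auto
      \<comment> \<open>If \<open>e\<close> came after \<open>f\<close>, its value would lie below
        \<open>f\<close>, hence below \<open>e\<close>, and \<open>e\<close> would not be an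
        excedance.\<close>
      have *: "e < f \<and> f < \<tau> e" if "e \<in> set es" for e
      proof -
        have e: "e \<in> set xs" "e < \<tau> e" using that by (auto simp: es_def)
        then obtain p where p: "p < length xs" "xs ! p = e" by (metis in_set_conv_nth)
        obtain q where q: "q < length xs" "xs ! q = f" using f_xs(1) by (auto simp: in_set_conv_nth)
        have "\<tau> (xs ! y) < \<tau> (xs ! x) \<and> xs ! x < xs ! y" if "x < y" "y < length xs" for x y
          using sorted_wrt_nth_less[OF xs(3) that] sorted_wrt_nth_less[OF xs(4), of x y] that by simp
        from this[of p q] this[of q p] show ?thesis
          using e(2) p q f_xs(2) by (cases p q rule: linorder_cases) auto
      qed
      show "e \<in> {1..f}" if "e \<in> set es" for e
        using *[OF that] that xs(2) by (auto simp: es_def)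
      show "f < \<tau> e" if "e \<in> set es" for e using *[OF that] by simp
    qed (rule \<open>length es = l\<close>)
    then show False using bounded f_xs xs(2) unfolding nesting_bounded_def by auto
  qed
next
  assume avoid: "\<not> has_descending_subseq (2 * l + 1) (n, \<tau>)"
  have no: False if "length ys \<ge> 2 * l + 1" "sorted_wrt (<) ys" "sorted_wrt (>) (map \<tau> ys)"
      "set ys \<subseteq> {1..n}" for ys
  proof -
    have "length (take (2 * l + 1) ys) = 2 * l + 1" "sorted_wrt (<) (take (2 * l + 1) ys)"
        "set (take (2 * l + 1) ys) \<subseteq> {1..n}"
      using that by (auto simp: sorted_wrt_take dest: in_set_takeD)
    moreover have "sorted_wrt (>) (map \<tau> (take (2 * l + 1) ys))"
      using sorted_wrt_take[OF that(3)] by (simp add: take_map)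
    ultimately have "has_descending_subseq (2 * l + 1) (n, \<tau>)"
      unfolding has_descending_subseq_def by blast
    then show False using avoid by simp
  qed
  have "\<not> nesting \<tau> j j (Suc l)" if j: "j \<le> n" for j
  proof
    assume "nesting \<tau> j j (Suc l)"
    then obtain as where as: "length as = Suc l"
        "sorted_wrt (<) (as @ rev (map \<tau> as))" "sorted_wrt (>) (map \<tau> (as @ rev (map \<tau> as)))"
        "set (as @ rev (map \<tau> as)) \<subseteq> {1..n}" "\<forall>a\<in>set as. a \<le> j \<and> j < \<tau> a"
      using j by (rule nesting_descending[OF inv perm])
    have "2 * l + 1 \<le> length (as @ rev (map \<tau> as))" using as(1) by simp
    from no[OF this as(2-4)] show False .
  qed
  moreover have "\<not> nesting \<tau> j j l" if "j \<in> {1..n}" "\<tau> j = j" for j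
  proof
    assume "nesting \<tau> j j l"
    moreover have "j \<le> n" using that by simp
    ultimately obtain as where as: "length as = l"
        "sorted_wrt (<) (as @ rev (map \<tau> as))" "sorted_wrt (>) (map \<tau> (as @ rev (map \<tau> as)))"
        "set (as @ rev (map \<tau> as)) \<subseteq> {1..n}" "\<forall>a\<in>set as. a \<le> j \<and> j < \<tau> a"
      by (rule nesting_descending[OF inv perm])
    let ?ys = "as @ j # rev (map \<tau> as)"
    have map: "map \<tau> (rev (map \<tau> as)) = rev as" by (simp add: rev_map inv comp_def)
    have lt: "\<forall>a\<in>set as. a < j \<and> j < \<tau> a" using as(5) that(2) by (metis le_neq_implies_less less_irrefl)
    have "sorted_wrt (<) ?ys" using as(2) lt by (auto simp: sorted_wrt_append)
    moreover have "sorted_wrt (>) (map \<tau> as @ rev as)" using as(3) map by simp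
    then have "sorted_wrt (>) (map \<tau> as @ j # rev as)"
      using lt unfolding sorted_wrt_append by simp
    then have "sorted_wrt (>) (map \<tau> ?ys)" using map that(2) by simp
    moreover have "set ?ys \<subseteq> {1..n}" "2 * l + 1 \<le> length ?ys" using as(1,4) that(1) by auto
    ultimately show False using no[of ?ys] by blast
  qed
  ultimately show "nesting_bounded l n \<tau> 0" by (auto simp: nesting_bounded_def)
qed

lemma avoiding_iff_growth:
  "(n, \<tau>) \<in> involutions_avoiding (2 * l) \<longleftrightarrow> growth l n \<tau> []"
proof
  assume "(n, \<tau>) \<in> involutions_avoiding (2 * l)"
  then have \<tau>: "\<tau> permutes {1..n}" "\<And>x. \<tau> (\<tau> x) = x" "\<not> has_descending_subseq (2 * l + 1) (n, \<tau>)"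
    by (auto simp: involutions_avoiding_def involutions_def fun_eq_iff)
  then have "nesting_bounded l n \<tau> 0" using nesting_bounded_iff_no_descending by blast
  then show "growth l n \<tau> []" using growth_exists[of 0 n \<tau> l] \<tau> by auto
next
  assume g: "growth l n \<tau> []"
  have \<tau>: "\<tau> permutes {1..n}" "\<And>x. \<tau> (\<tau> x) = x" using growth_coherent[OF g] by (auto simp: coherent_def)
  then show "(n, \<tau>) \<in> involutions_avoiding (2 * l)"
    using growth_nesting_bounded[OF g] nesting_bounded_iff_no_descending[OF \<tau>(2,1)]
    by (auto simp: involutions_avoiding_def involutions_def fun_eq_iff)
qed

subsection \<open>Coefficients of the Laurent series as signed walks\<close>

text \<open>The coefficient of the monomial with exponents \<open>y\<close> in the determinant. As
  column \<open>j\<close> involves one variable only, the coefficient can be taken in each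
  entry.\<close>

definition alternant :: "nat \<Rightarrow> (nat \<Rightarrow> int) \<Rightarrow> rat" where
  "alternant l y = det (mat l l (\<lambda>(i, j).
     (if y j = int i then 1 else 0) + (if y j = - int (Suc i) then 1 else 0)))"

text \<open>The sum of \<open>alternant\<close> over the end points of all free walks of
  \<open>k\<close> steps from \<open>y\<close>.\<close>

primrec signed_walks :: "nat \<Rightarrow> nat \<Rightarrow> (nat \<Rightarrow> int) \<Rightarrow> rat" where
  "signed_walks l 0 y = alternant l y"
| "signed_walks l (Suc k) y =
     (\<Sum>j<l. signed_walks l k (y(j := y j + 1)) + signed_walks l k (y(j := y j - 1)))"

lemma alternant_transpose:
  assumes "a < l" "b < l" "a \<noteq> b"
  shows "alternant l (y \<circ> transpose a b) = - alternant l y"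
proof -
  let ?A = "\<lambda>y. mat l l (\<lambda>(i, j).
     (if y j = int i then 1 else 0) + (if y j = - int (Suc i) then 1 else 0)) :: rat mat"
  have "?A (y \<circ> transpose a b) = swapcols a b (?A y)"
    using assms by (intro eq_matI) (auto simp: transpose_def)
  then show ?thesis
    using det_swapcols[OF assms, of "?A y"] by (simp add: alternant_def)
qed

lemma signed_walks_transpose:
  assumes "a < l" "b < l" "a \<noteq> b"
  shows "signed_walks l k (y \<circ> transpose a b) = - signed_walks l k y"
proof (induction k arbitrary: y)
  case 0
  show ?case unfolding signed_walks.simps by (rule alternant_transpose[OF assms])
next
  case (Suc k)
  let ?t = "transpose a b"
  let ?f = "\<lambda>j. signed_walks l k (y(j := y j + 1)) + signed_walks l k (y(j := y j - 1))"
  have upd: "(y \<circ> ?t)(j := z) = y(?t j := z) \<circ> ?t" for j z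
    by (auto simp: fun_eq_iff transpose_eq_iff)
  have "signed_walks l (Suc k) (y \<circ> ?t) = (\<Sum>j<l. - ?f (?t j))"
    by (simp add: upd Suc.IH del: fun_upd_apply)
  also have "\<dots> = - (\<Sum>j<l. ?f (?t j))" by (rule sum_negf)
  also have "(\<Sum>j<l. ?f (?t j)) = (\<Sum>j<l. ?f j)"
    by (rule sum.reindex_bij_betw) (use assms permutes_swap_id[of a "{..<l}" b] in \<open>auto simp: permutes_imp_bij\<close>)
  finally show ?case by simp
qed

lemma signed_walks_collision:
  assumes "a < l" "b < l" "a \<noteq> b" "y a = y b"
  shows "signed_walks l k y = 0"
proof -
  have "y \<circ> transpose a b = y" using assms(4) by (auto simp: fun_eq_iff transpose_def)
  then show ?thesis using signed_walks_transpose[OF assms(1-3), of k y] by simp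
qed

text \<open>The reflection exchanges the two summands of each entry in column \<open>a\<close>, and
  the two steps of particle \<open>a\<close>. At \<open>y a = 0\<close> it identifies a step to
  \<open>- 1\<close> with staying at \<open>0\<close>.\<close>

lemma signed_walks_reflect:
  assumes "a < l"
  shows "signed_walks l k (y(a := - 1 - y a)) = signed_walks l k y"
proof (induction k arbitrary: y)
  case 0
  show ?case
    unfolding signed_walks.simps alternant_def
    by (intro arg_cong[where f = det] eq_matI) auto
next
  case (Suc k)
  let ?f = "\<lambda>y j. signed_walks l k (y(j := y j + 1)) + signed_walks l k (y(j := y j - 1))"
  have "?f (y(a := - 1 - y a)) j = ?f y j" for j
  proof (cases "j = a")
    case True
    have flip: "signed_walks l k (y(a := - 1 - z)) = signed_walks l k (y(a := z))" for z
      using Suc.IH[of "y(a := z)"] by (simp only: fun_upd_upd fun_upd_same)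
    have "signed_walks l k (y(a := - y a)) = signed_walks l k (y(a := y a - 1))"
      "signed_walks l k (y(a := - 2 - y a)) = signed_walks l k (y(a := y a + 1))"
      using flip[of "y a - 1"] flip[of "y a + 1"] by simp_all
    then show ?thesis using True by simp
  next
    case False
    have comm: "(y(a := - 1 - y a))(j := z) = (y(j := z))(a := - 1 - (y(j := z)) a)" for z
      using False by (auto simp: fun_eq_iff)
    show ?thesis by (simp only: comm Suc.IH fun_upd_other[OF False])
  qed
  then show ?case by (simp only: signed_walks.simps)
qed

lemma alternant_staircase:
  assumes "\<And>j. j < l \<Longrightarrow> y j = int j"
  shows "alternant l y = 1"
proof -
  have "mat l l (\<lambda>(i, j). (if y j = int i then 1 else 0) + (if y j = - int (Suc i) then 1 else 0))
      = (1\<^sub>m l :: rat mat)"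
    using assms by (intro eq_matI) auto
  then show ?thesis by (simp add: alternant_def)
qed

text \<open>Column \<open>a\<close> vanishes, because its exponents are all less than
  \<open>l\<close>. This makes every nonempty tableau contribute \<open>0\<close> at the end of a
  walk.\<close>

lemma alternant_large:
  assumes "a < l" "y a \<ge> int l"
  shows "alternant l y = 0"
proof -
  let ?A = "mat l l (\<lambda>(i, j). (if y j = int i then 1 else 0) +
      (if y j = - int (Suc i) then 1 else 0)) :: rat mat"
  have zero: "(\<Prod>j<l. ?A $$ (p j, j)) = 0" if p: "p permutes {0..<l}" for p
  proof (rule prod_zero)
    have "p a < l" using permutes_in_image[OF p, of a] assms(1) by simp
    then show "\<exists>j\<in>{..<l}. ?A $$ (p j, j) = 0"
      using assms by (intro bexI[of _ a]) auto
  qed simp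
  have "alternant l y = (\<Sum>p | p permutes {0..<l}. signof p * (\<Prod>j<l. ?A $$ (p j, j)))"
    unfolding alternant_def by (rule det_col) simp
  also have "\<dots> = 0"
    by (intro sum.neutral ballI) (simp only: mem_Collect_eq zero mult_zero_right)
  finally show ?thesis .
qed

section \<open>Coefficients of Laurent polynomials\<close>

lemma lookup_single_mult:
  fixes Q :: "'a::ab_group_add \<Rightarrow>\<^sub>0 'b::comm_semiring_1"
  shows "Poly_Mapping.lookup (Poly_Mapping.single \<kappa> c * Q) \<mu> = c * Poly_Mapping.lookup Q (\<mu> - \<kappa>)"
proof -
  have "(\<mu> = k + q) = (q = \<mu> - k)" for k q by (auto simp: algebra_simps)
  then show ?thesis
    by (simp add: lookup_mult lookup_single when_mult)
qed

text \<open>The factors involve distinct variables, so a coefficient is the product of theirs; it is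
  \<open>0\<close> if \<open>\<mu>\<close> involves any other variable.\<close>

lemma lookup_prod_binomials:
  fixes a b :: "nat \<Rightarrow> int"
  assumes "finite J"
  shows "Poly_Mapping.lookup (\<Prod>j\<in>J. Poly_Mapping.single (Poly_Mapping.single (Suc j) (a j)) 1 +
        Poly_Mapping.single (Poly_Mapping.single (Suc j) (b j)) 1 :: laurent) \<mu> =
    (if \<forall>i. i \<notin> Suc ` J \<longrightarrow> Poly_Mapping.lookup \<mu> i = 0 then
       (\<Prod>j\<in>J. (if Poly_Mapping.lookup \<mu> (Suc j) = a j then 1 else 0) +
                (if Poly_Mapping.lookup \<mu> (Suc j) = b j then 1 else 0)) else 0)"
  using assms
proof (induction J arbitrary: \<mu>)
  case empty
  have "(\<mu> = 0) = (\<forall>i. Poly_Mapping.lookup \<mu> i = 0)"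
    by (metis lookup_zero poly_mapping_eqI)
  then show ?case by (auto simp: lookup_one)
next
  case (insert j J)
  let ?P = "\<lambda>J. \<forall>i. i \<notin> Suc ` J \<longrightarrow> Poly_Mapping.lookup \<mu> i = 0"
  let ?g = "\<lambda>j. (if Poly_Mapping.lookup \<mu> (Suc j) = a j then 1 else 0) +
                (if Poly_Mapping.lookup \<mu> (Suc j) = b j then 1 else (0::rat))"
  let ?Q = "\<Prod>j\<in>J. Poly_Mapping.single (Poly_Mapping.single (Suc j) (a j)) 1 +
        Poly_Mapping.single (Poly_Mapping.single (Suc j) (b j)) 1 :: laurent"
  have *: "Poly_Mapping.lookup ?Q (\<mu> - Poly_Mapping.single (Suc j) c) =
      (if ?P (insert j J) \<and> Poly_Mapping.lookup \<mu> (Suc j) = c then \<Prod>j\<in>J. ?g j else 0)" for c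
  proof -
    let ?\<nu> = "\<mu> - Poly_Mapping.single (Suc j) c"
    have \<nu>: "Poly_Mapping.lookup ?\<nu> i = (if i = Suc j then Poly_Mapping.lookup \<mu> i - c else Poly_Mapping.lookup \<mu> i)" for i
      by (auto simp: lookup_minus lookup_single when_def)
    have supp: "(\<forall>i. i \<notin> Suc ` J \<longrightarrow> Poly_Mapping.lookup ?\<nu> i = 0) \<longleftrightarrow>
        ?P (insert j J) \<and> Poly_Mapping.lookup \<mu> (Suc j) = c"
      unfolding \<nu> using insert.hyps(2) by auto
    have prod: "(\<Prod>j\<in>J. (if Poly_Mapping.lookup ?\<nu> (Suc j) = a j then 1 else 0) +
                (if Poly_Mapping.lookup ?\<nu> (Suc j) = b j then 1 else (0::rat))) = (\<Prod>j\<in>J. ?g j)"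
      unfolding \<nu> using insert.hyps(2) by (intro prod.cong) auto
    show ?thesis by (simp only: insert.IH supp prod)
  qed
  show ?case
    unfolding prod.insert[OF insert.hyps] distrib_right lookup_add lookup_single_mult *
    by (auto simp: distrib_right)
qed

text \<open>Particles are numbered from \<open>0\<close> and variables from \<open>1\<close>, so
  coordinate \<open>j\<close> is the exponent of \<open>X (Suc j)\<close>.\<close>

definition exponent :: "nat \<Rightarrow> (nat \<Rightarrow> int) \<Rightarrow> nat \<Rightarrow>\<^sub>0 int" where
  "exponent l y = (\<Sum>j<l. Poly_Mapping.single (Suc j) (y j))"

lemma lookup_exponent:
  "Poly_Mapping.lookup (exponent l y) i = (if i \<in> Suc ` {..<l} then y (i - 1) else 0)"
proof (cases i)
  case (Suc j)
  have "Poly_Mapping.lookup (exponent l y) (Suc j) = (\<Sum>k<l. if k = j then y k else 0)"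
    unfolding exponent_def lookup_sum by (intro sum.cong) (auto simp: lookup_single when_def)
  then show ?thesis using Suc by auto
qed (auto simp: exponent_def lookup_sum lookup_single when_def)

lemma exponent_minus_single:
  assumes "j < l"
  shows "exponent l y - Poly_Mapping.single (Suc j) c = exponent l (y(j := y j - c))"
proof (rule poly_mapping_eqI)
  fix i
  show "Poly_Mapping.lookup (exponent l y - Poly_Mapping.single (Suc j) c) i =
      Poly_Mapping.lookup (exponent l (y(j := y j - c))) i"
    using assms by (cases i) (auto simp: lookup_minus lookup_exponent lookup_single when_def)
qed

lemma staircase_eq_exponent: "staircase l = exponent l int"
  unfolding staircase_def exponent_def by (simp add: sum.atLeast1_atMost_eq)

lemma X_power: "X j ^ k = Poly_Mapping.single (Poly_Mapping.single j (int k)) 1"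
  by (induction k) (simp_all add: X_def mult_single flip: single_add)

lemma Xbar_power: "Xbar j ^ k = Poly_Mapping.single (Poly_Mapping.single j (- int k)) 1"
  by (induction k) (simp_all add: Xbar_def mult_single flip: single_add)

abbreviation weyl_det :: "nat \<Rightarrow> laurent" where
  "weyl_det l \<equiv> det (mat l l (\<lambda>(i, j). X (Suc j) ^ i + Xbar (Suc j) ^ Suc i))"

abbreviation step_sum :: "nat \<Rightarrow> laurent" where
  "step_sum l \<equiv> (\<Sum>j = 1..l. X j) + (\<Sum>j = 1..l. Xbar j)"

lemma lookup_sign_mult:
  "Poly_Mapping.lookup (of_int (sign p) * Q :: laurent) \<mu> = of_int (sign p) * Poly_Mapping.lookup Q \<mu>"
  by (simp add: sign_def)

text \<open>In the Leibniz expansion by columns, the factor from column \<open>j\<close> involves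
  \<open>X (Suc j)\<close> only, so \<open>lookup_prod_binomials\<close> applies to each
  term.\<close>

lemma lookup_weyl_det: "Poly_Mapping.lookup (weyl_det l) (exponent l y) = alternant l y"
proof -
  have "Poly_Mapping.lookup (\<Prod>j<l. mat l l (\<lambda>(i, j). X (Suc j) ^ i + Xbar (Suc j) ^ Suc i) $$ (p j, j))
        (exponent l y) =
      (\<Prod>j<l. mat l l (\<lambda>(i, j). (if y j = int i then 1 else 0) +
        (if y j = - int (Suc i) then 1 else 0)) $$ (p j, j))" (is "?L = ?R")
    if p: "p permutes {0..<l}" for p
  proof -
    have p_less: "p j < l" if "j < l" for j using permutes_in_image[OF p, of j] that by simp
    have "?L = Poly_Mapping.lookup (\<Prod>j<l. Poly_Mapping.single (Poly_Mapping.single (Suc j) (int (p j))) 1 +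
        Poly_Mapping.single (Poly_Mapping.single (Suc j) (- int (Suc (p j)))) 1 :: laurent) (exponent l y)"
      using p_less by (intro arg_cong2[where f = Poly_Mapping.lookup] prod.cong)
        (simp_all add: X_power Xbar_power del: power_Suc)
    also have "\<dots> = (\<Prod>j<l. (if y j = int (p j) then 1 else 0) + (if y j = - int (Suc (p j)) then 1 else 0))"
      by (subst lookup_prod_binomials) (auto simp: lookup_exponent intro!: prod.cong)
    also have "\<dots> = ?R" using p_less by (intro prod.cong) simp_all
    finally show ?thesis .
  qed
  then show ?thesis
    unfolding alternant_def
    by (subst (1 2) det_col[of _ l]) (simp_all add: lookup_sum lookup_sign_mult)
qed

text \<open>Multiplying by \<open>step_sum l\<close> shifts one coordinate of the exponent by one in
  either direction, which is the recursion of \<open>signed_walks\<close>.\<close>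

lemma lookup_signed_walks:
  "Poly_Mapping.lookup (weyl_det l * step_sum l ^ k) (exponent l y) = signed_walks l k y"
proof (induction k arbitrary: y)
  case 0
  show ?case using lookup_weyl_det[of l y] by simp
next
  case (Suc k)
  define Q where "Q = weyl_det l * step_sum l ^ k"
  have shift: "Poly_Mapping.lookup (Poly_Mapping.single (Poly_Mapping.single (Suc j) c) 1 * Q) (exponent l y)
      = signed_walks l k (y(j := y j - c))" if "j < l" for j c
    using that by (simp only: lookup_single_mult exponent_minus_single mult_1 Q_def Suc.IH)
  have "weyl_det l * step_sum l ^ Suc k = step_sum l * Q"
    unfolding power_Suc Q_def by (rule mult.left_commute)
  also have "\<dots> = (\<Sum>j<l. Poly_Mapping.single (Poly_Mapping.single (Suc j) 1) 1 * Q) +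
      (\<Sum>j<l. Poly_Mapping.single (Poly_Mapping.single (Suc j) (- 1)) 1 * Q)"
    by (simp add: sum.atLeast1_atMost_eq X_def Xbar_def distrib_right sum_distrib_right)
  also have "Poly_Mapping.lookup \<dots> (exponent l y) =
      (\<Sum>j<l. signed_walks l k (y(j := y j - 1))) + (\<Sum>j<l. signed_walks l k (y(j := y j - - 1)))"
    unfolding lookup_add lookup_sum
    by (intro arg_cong2[where f = "(+)"] sum.cong refl) (simp_all only: shift lessThan_iff)
  also have "\<dots> = signed_walks l (Suc k) y"
    by (simp add: sum.distrib)
  finally show ?case .
qed

section \<open>Geometric and exponential series\<close>

lemma recip_geometric:
  "recip (1 - fps_X * fps_const a) = Abs_fps (\<lambda>n. a ^ n)" (is "recip ?F = ?G")
proof -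
  have "?F * ?G = ?G - fps_X * (fps_const a * ?G)"
    by (simp only: left_diff_distrib mult_1 mult.assoc)
  moreover have "?G - fps_X * (fps_const a * ?G) = 1"
  proof (rule fps_ext)
    fix n
    show "fps_nth (?G - fps_X * (fps_const a * ?G)) n = fps_nth 1 n"
      by (cases n) (simp_all only: fps_sub_nth fps_X_mult_nth fps_mult_left_const_nth
        fps_nth_Abs_fps fps_one_nth power_0 power_Suc, simp_all)
  qed
  ultimately have "?F * ?G = 1" by (rule trans)
  \<comment> \<open>Two right inverses agree: \<open>?F * ?G * recip ?F\<close> is evaluated in two
    ways.\<close>
  then have "recip ?F = ?F * ?G * recip ?F" by (simp only: mult_1)
  also have "\<dots> = ?G * (?F * recip ?F)" by (simp only: mult_ac)
  also have "?F * recip ?F = 1" by (rule mult_recip) simp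
  finally show ?thesis by (simp only: mult_1_right)
qed

lemma exp_t_0: "exp_t 0 = 1"
  by (rule fps_ext) (simp add: exp_t_def power_0_left flip: single_one)

lemma exp_t_add: "exp_t (a + b) = exp_t a * exp_t b"
proof (rule fps_ext)
  fix n
  have coeff: "Poly_Mapping.single 0 (1 / fact n) * of_nat (n choose k) =
      (Poly_Mapping.single 0 (1 / fact k) * Poly_Mapping.single 0 (1 / fact (n - k)) :: laurent)"
    if "k \<le> n" for k
    using that by (simp add: mult_single binomial_fact flip: single_of_nat)
  have "fps_nth (exp_t (a + b)) n =
      (\<Sum>k\<le>n. Poly_Mapping.single 0 (1 / fact n) * of_nat (n choose k) * (a ^ k * b ^ (n - k)))"
    by (simp add: exp_t_def binomial_ring sum_distrib_left mult.assoc)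
  also have "\<dots> = (\<Sum>k\<le>n. (Poly_Mapping.single 0 (1 / fact k) * a ^ k) *
      (Poly_Mapping.single 0 (1 / fact (n - k)) * b ^ (n - k)))"
    by (intro sum.cong refl) (subst coeff, simp, simp only: mult_ac)
  also have "\<dots> = fps_nth (exp_t a * exp_t b) n"
    by (simp add: exp_t_def fps_mult_nth atLeast0AtMost)
  finally show "fps_nth (exp_t (a + b)) n = fps_nth (exp_t a * exp_t b) n" .
qed

lemma exp_t_sum: "finite A \<Longrightarrow> exp_t (sum f A) = (\<Prod>a\<in>A. exp_t (f a))"
  by (induction A rule: finite_induct) (simp_all add: exp_t_0 exp_t_add)

lemma det_scale_columns:
  "det (mat n n (\<lambda>(i, j). a i j * c j)) = det (mat n n (\<lambda>(i, j). a i j)) * (\<Prod>j<n. c j :: 'a::comm_ring_1)"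
proof -
  have "(\<Prod>j<n. mat n n (\<lambda>(i, j). a i j * c j) $$ (p j, j)) =
      (\<Prod>j<n. mat n n (\<lambda>(i, j). a i j) $$ (p j, j)) * (\<Prod>j<n. c j)" if "p permutes {0..<n}" for p
    unfolding prod.distrib[symmetric]
    using permutes_in_image[OF that] by (intro prod.cong) auto
  then show ?thesis
    by (subst (1 2) det_col[of _ n]) (simp_all add: sum_distrib_right mult.assoc)
qed

lemma det_fps_const:
  "det (mat n n (\<lambda>(i, j). fps_const (a i j))) = fps_const (det (mat n n (\<lambda>(i, j). a i j :: 'a::comm_ring_1)))"
proof -
  interpret comm_ring_hom "fps_const :: 'a \<Rightarrow> 'a fps"
    by unfold_locales simp_all
  have "mat n n (\<lambda>(i, j). fps_const (a i j)) = map_mat fps_const (mat n n (\<lambda>(i, j). a i j))"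
    by (intro eq_matI) auto
  then show ?thesis by simp
qed

lemma coeff_ordinary:
  "fps_nth (extract_coeff \<mu> (fps_const d * recip (1 - fps_X * fps_const s))) n =
     Poly_Mapping.lookup (d * s ^ n) \<mu>"
  by (simp add: extract_coeff_def recip_geometric)

text \<open>The exponential factor of an entry depends on its column only, and the product of these
  factors is \<open>exp_t (step_sum l)\<close>. So the coefficient is that of the ordinary case up
  to the factor \<open>1 / fact n\<close>.\<close>

lemma coeff_exponential:
  "fps_nth (extract_coeff (exponent l y)
      (det (mat l l (\<lambda>(i, j). fps_const (X (Suc j) ^ i + Xbar (Suc j) ^ Suc i) *
                                  exp_t (X (Suc j) + Xbar (Suc j)))))) n =
    1 / fact n * Poly_Mapping.lookup (weyl_det l * step_sum l ^ n) (exponent l y)"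
proof -
  have "(\<Prod>j<l. exp_t (X (Suc j) + Xbar (Suc j))) = exp_t (step_sum l)"
    by (simp add: exp_t_sum sum.atLeast1_atMost_eq sum.distrib flip: exp_t_sum)
  then have "det (mat l l (\<lambda>(i, j). fps_const (X (Suc j) ^ i + Xbar (Suc j) ^ Suc i) *
      exp_t (X (Suc j) + Xbar (Suc j)))) = fps_const (weyl_det l) * exp_t (step_sum l)"
    by (simp only: det_scale_columns det_fps_const)
  moreover have "weyl_det l * (Poly_Mapping.single 0 (1 / fact n) * step_sum l ^ n) =
      Poly_Mapping.single 0 (1 / fact n) * (weyl_det l * step_sum l ^ n)"
    by (rule mult.left_commute)
  ultimately show ?thesis
    by (simp only: extract_coeff_def fps_nth_Abs_fps fps_mult_left_const_nth exp_t_def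
      lookup_single_mult diff_zero)
qed

subsection \<open>Counting involutions by signed walks\<close>

definition column_len :: "nat option list \<Rightarrow> nat \<Rightarrow> nat" where
  "column_len u c = card {p. c < row_len u p}"

text \<open>
  Particle \<open>j\<close> belongs to column \<open>l - 1 - j\<close>. The value beyond \<open>l\<close> is \<open>0\<close> so that adding a box is an
  update of the whole function.
\<close>
definition particles :: "nat \<Rightarrow> nat option list \<Rightarrow> nat \<Rightarrow> int" where
  "particles l u j = (if j < l then int (j + column_len u (l - 1 - j)) else 0)"

lemma finite_long_rows: "finite {p. c < row_len u p}"
proof (rule finite_subset)
  show "{p. c < row_len u p} \<subseteq> {p. Some p \<in> set u}"
    using count_notin[of _ u] by (fastforce simp: row_len_def)
  have "{p. Some p \<in> set u} = Some -` set u" by auto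
  then show "finite {p. Some p \<in> set u}" by (simp add: finite_vimageI)
qed

lemma exists_empty_row: "\<exists>p. row_len u p = 0"
  using finite_long_rows[of 0 u] ex_new_if_finite[OF infinite_UNIV_nat] by fastforce

text \<open>The new box at the end of row \<open>p\<close> lies in column
  \<open>row_len u p\<close>, whose particle moves one site to the right.\<close>

lemma particles_add_box:
  assumes "\<And>q. row_len v q = row_len u q + (if q = p then 1 else 0)" "row_len u p < l"
    and "j = l - 1 - row_len u p"
  shows "particles l v = (particles l u)(j := particles l u j + 1)"
proof -
  have "column_len v c = column_len u c + (if c = row_len u p then 1 else 0)" for c
  proof (cases "c = row_len u p")
    case True
    then have "{q. c < row_len v q} = insert p {q. c < row_len u q}" by (auto simp: assms(1))
    then show ?thesis using True finite_long_rows[of c u] by (simp add: column_len_def)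
  next
    case False
    then have "{q. c < row_len v q} = {q. c < row_len u q}" by (auto simp: assms(1))
    then show ?thesis using False by (simp add: column_len_def)
  qed
  then show ?thesis using assms(2,3) by (auto simp: particles_def fun_eq_iff)
qed

text \<open>Only rows of length \<open>Suc c\<close> reach column \<open>c\<close> but not column
  \<open>Suc c\<close>. If there is none, the particles of these two columns occupy neighbouring
  sites.\<close>

lemma column_len_Suc:
  assumes "\<And>p. row_len u p \<noteq> Suc c"
  shows "column_len u (Suc c) = column_len u c"
proof -
  have "(Suc c < row_len u p) = (c < row_len u p)" for p
    using assms[of p] by auto
  then show ?thesis by (simp add: column_len_def)
qed

section \<open>Steps of the particles and corners of the tableau\<close>

definition addable :: "nat \<Rightarrow> nat option list \<Rightarrow> nat set" where
  "addable l u = {p. row_len u p < l \<and> (p = 0 \<or> row_len u p < row_len u (p - 1))}"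

definition removable :: "nat option list \<Rightarrow> nat set" where
  "removable u = {p. row_len u (Suc p) < row_len u p}"

lemma finite_addable: "finite (addable l u)"
proof (rule finite_subset)
  show "addable l u \<subseteq> insert 0 (Suc ` {p. 0 < row_len u p})"
    by (auto simp: addable_def image_iff) (metis Suc_pred gr0I not_less_zero)
qed (simp add: finite_long_rows)

lemma finite_removable: "finite (removable u)"
  by (rule finite_subset[OF _ finite_long_rows[of 0 u]]) (auto simp: removable_def)

lemma inj_on_addable:
  assumes "yamanouchi u"
  shows "inj_on (row_len u) (addable l u)"
proof -
  have "row_len u q < row_len u p" if "p < q" "q \<in> addable l u" for p q
  proof -
    have "p \<le> q - 1" using that(1) by simp
    from yamanouchi_row_len_antimono[OF assms this] show ?thesis
      using that by (auto simp: addable_def)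
  qed
  then show ?thesis by (metis inj_onI less_irrefl linorder_neqE_nat)
qed

lemma inj_on_removable:
  assumes "yamanouchi u"
  shows "inj_on (row_len u) (removable u)"
proof -
  have "row_len u q < row_len u p" if "p < q" "p \<in> removable u" for p q
    using that yamanouchi_row_len_antimono[OF assms, of "Suc p" q] by (auto simp: removable_def)
  then show ?thesis by (metis inj_onI less_irrefl linorder_neqE_nat)
qed

text \<open>A right step of particle \<open>j\<close> adds a box to column \<open>l - 1 - j\<close>.
  If the result is not a partition, the particle hits its right neighbour and the term is
  \<open>0\<close> by \<open>signed_walks_collision\<close>.\<close>

lemma sum_up_steps:
  assumes yam: "yamanouchi u"
  shows "(\<Sum>j<l. signed_walks l k ((particles l u)(j := particles l u j + 1))) =
    (\<Sum>p\<in>addable l u. signed_walks l k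
       ((particles l u)(l - 1 - row_len u p := particles l u (l - 1 - row_len u p) + 1)))"
    (is "sum ?g _ = sum (\<lambda>p. ?g (?col p)) _")
proof -
  have inj: "inj_on ?col (addable l u)"
  proof (rule inj_onI)
    fix p q assume pq: "p \<in> addable l u" "q \<in> addable l u" "?col p = ?col q"
    then have "row_len u p < l" "row_len u q < l" by (simp_all add: addable_def)
    then have "row_len u p = row_len u q" using pq(3) by linarith
    then show "p = q" using inj_onD[OF inj_on_addable[OF yam]] pq(1,2) by blast
  qed
  have "sum ?g {..<l} = sum ?g (?col ` addable l u)"
  proof (rule sum.mono_neutral_right)
    show "?col ` addable l u \<subseteq> {..<l}" by (auto simp: addable_def)
    show "\<forall>j\<in>{..<l} - ?col ` addable l u. ?g j = 0"
    proof
      fix j assume j: "j \<in> {..<l} - ?col ` addable l u"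
      have none: "row_len u p \<noteq> l - 1 - j" for p
      proof
        assume "row_len u p = l - 1 - j"
        define q where "q = (LEAST q. row_len u q = l - 1 - j)"
        have q: "row_len u q = l - 1 - j"
          unfolding q_def by (rule LeastI) fact
        have "q = 0 \<or> row_len u (q - 1) \<noteq> l - 1 - j"
          using not_less_Least[of "q - 1" "\<lambda>q. row_len u q = l - 1 - j"] unfolding q_def[symmetric] by auto
        then have "q = 0 \<or> row_len u q < row_len u (q - 1)"
          using q yamanouchi_row_len_antimono[OF yam, of "q - 1" q] by auto
        then have "q \<in> addable l u" using q j by (auto simp: addable_def)
        moreover have "j = ?col q" using q j by auto
        ultimately show False using j by blast
      qed
      \<comment> \<open>Column \<open>0\<close> is never blocked, because some row is empty.\<close>
      then have "l - 1 - j \<noteq> 0" using exists_empty_row[of u] by metis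
      then obtain c where c: "l - 1 - j = Suc c" by (cases "l - 1 - j") auto
      then have "l - 1 - Suc j = c" "Suc j < l" by auto
      then have "particles l u (Suc j) = particles l u j + 1"
        using column_len_Suc[of u c] none c by (simp add: particles_def)
      then show "?g j = 0"
        using \<open>Suc j < l\<close> by (intro signed_walks_collision[of j l "Suc j"]) auto
    qed
  qed simp
  then show ?thesis by (simp only: sum.reindex[OF inj] comp_def)
qed

text \<open>A left step of particle \<open>j\<close> removes a box from column
  \<open>l - 1 - j\<close>, that is, from a row of length \<open>l - j\<close>. Without such a row
  the particle hits its left neighbour, except for particle \<open>0\<close> at site
  \<open>0\<close>, which is reflected and gives the last summand.\<close>

lemma sum_down_steps:
  assumes yam: "yamanouchi u" and le: "row_len u 0 \<le> l" and "0 < l"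
  shows "(\<Sum>j<l. signed_walks l k ((particles l u)(j := particles l u j - 1))) =
    (\<Sum>p\<in>removable u. signed_walks l k
       ((particles l u)(l - row_len u p := particles l u (l - row_len u p) - 1))) +
    (if row_len u 0 < l then signed_walks l k (particles l u) else 0)"
    (is "sum ?g _ = sum (\<lambda>p. ?g (?col p)) _ + ?r")
proof -
  have bound: "row_len u p \<le> l" for p
    using yamanouchi_row_len_antimono[OF yam, of 0 p] le by simp
  have inj: "inj_on ?col (removable u)"
    using inj_on_removable[OF yam] bound unfolding inj_on_def by (metis diff_diff_cancel)
  have sub: "?col ` removable u \<subseteq> {..<l}" using \<open>0 < l\<close> by (auto simp: removable_def)
  have none: "row_len u p \<noteq> l - j" if j: "j \<in> {..<l} - ?col ` removable u" for j p
  proof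
    assume p: "row_len u p = l - j"
    \<comment> \<open>The largest element is the lowest row of length \<open>l - j\<close>, which
      ends in a removable corner.\<close>
    let ?S = "{q. row_len u q = l - j}"
    have "finite ?S" by (rule finite_subset[OF _ finite_long_rows[of 0 u]]) (use j in auto)
    moreover have "?S \<noteq> {}" using p by auto
    ultimately have "Max ?S \<in> ?S" "Suc (Max ?S) \<notin> ?S"
      using Max_in[of ?S] Max_ge[of ?S "Suc (Max ?S)"] not_less_eq_eq by blast+
    then have q: "row_len u (Max ?S) = l - j" "row_len u (Suc (Max ?S)) \<noteq> row_len u (Max ?S)" by auto
    then have "Max ?S \<in> removable u"
      using yamanouchi_row_len_Suc[OF yam, of "Max ?S"] by (auto simp: removable_def)
    moreover have "j = ?col (Max ?S)" using q j by auto
    ultimately show False using j by blast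
  qed
  have zero: "?g j = 0" if j: "j \<in> {..<l} - ?col ` removable u" "j \<noteq> 0" for j
  proof -
    obtain i where i: "j = Suc i" using j(2) by (cases j) auto
    have "l - 1 - i = Suc (l - 1 - j)" "l - j = Suc (l - 1 - j)" using j i by auto
    then have "particles l u j - 1 = particles l u i"
      using column_len_Suc[of u "l - 1 - j"] none[OF j(1)] j i by (simp add: particles_def)
    then show ?thesis
      using j i by (intro signed_walks_collision[of j l i]) auto
  qed
  have rest: "sum ?g ({..<l} - ?col ` removable u) = ?r"
  proof (cases "row_len u 0 < l")
    case True
    then have less: "row_len u p < l" for p
      using yamanouchi_row_len_antimono[OF yam, of 0 p] by simp
    have notin: "0 \<notin> ?col ` removable u"
    proof
      assume "0 \<in> ?col ` removable u"
      then obtain p where "l - row_len u p = 0" by force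
      then show False using less[of p] by linarith
    qed
    \<comment> \<open>No row reaches column \<open>l - 1\<close>, so particle \<open>0\<close> is at
      site \<open>0\<close>, and \<open>signed_walks_reflect\<close> turns its step to
      \<open>- 1\<close> into staying there.\<close>
    have "\<not> l - 1 < row_len u p" for p using less[of p] by linarith
    then have "particles l u 0 = 0" by (simp add: particles_def column_len_def)
    then have "?g 0 = signed_walks l k (particles l u)"
      using signed_walks_reflect[OF \<open>0 < l\<close>, of k "particles l u"] by simp
    moreover have "sum ?g ({..<l} - ?col ` removable u) = sum ?g {0}"
      by (rule sum.mono_neutral_right) (use zero notin \<open>0 < l\<close> in auto)
    ultimately show ?thesis using True by simp
  next
    case False
    then have "row_len u 0 = l - 0" using le by simp
    then have "0 \<notin> {..<l} - ?col ` removable u" using none[of 0 0] by metis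
    then show ?thesis using zero False by (intro trans[OF sum.neutral]) metis+
  qed
  have "sum ?g {..<l} = sum ?g (?col ` removable u) + sum ?g ({..<l} - ?col ` removable u)"
    using sub by (simp add: sum.subset_diff add.commute)
  then show ?thesis by (simp only: rest sum.reindex[OF inj] comp_def)
qed

lemma finite_growth: "finite {\<tau>. growth l n \<tau> u}"
  by (rule finite_subset[OF _ finite_permutations[of "{1..n}"]])
    (auto dest: growth_coherent simp: coherent_def)

text \<open>Induction on \<open>n - length u\<close>, with the involutions split by the last rule:
  openers match right steps, closers match left steps, and fixed points match the reflected left
  step of particle \<open>0\<close>. Since insertion is invertible, the count depends on the shape
  only.\<close>

lemma card_growth:
  assumes "0 < l"
  shows "yamanouchi u \<Longrightarrow> row_len u 0 \<le> l \<Longrightarrow> length u \<le> n \<Longrightarrow>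
    of_nat (card {\<tau>. growth l n \<tau> u}) = signed_walks l (n - length u) (particles l u)"
proof (induction "n - length u" arbitrary: u)
  case 0
  then have len: "length u = n" by simp
  show ?case
  proof (cases "u = replicate n None")
    case True
    have "\<tau> = id" if "growth l n \<tau> u" for \<tau>
      using that by cases (use len growth_length[of l n] insertion_length in fastforce)+
    then have "{\<tau>. growth l n \<tau> u} = {id}" using True growth.empty by auto
    moreover have "alternant l (particles l u) = 1"
      using True by (intro alternant_staircase) (simp add: particles_def column_len_def)
    ultimately show ?thesis using len by simp
  next
    case False
    have "u = replicate n None" if "growth l n \<tau> u" for \<tau>
      using that by cases (use len growth_length[of l n] insertion_length in fastforce)+
    then have "{\<tau>. growth l n \<tau> u} = {}" using False by auto
    moreover have "\<exists>p. Some p \<in> set u"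
      using False len by (metis option.exhaust replicate_length_same)
    then obtain p where "Some p \<in> set u" by blast
    then have "row_len u p \<noteq> 0" by (simp add: row_len_def count_list_0_iff)
    then have "p \<in> {p. 0 < row_len u p}" by simp
    \<comment> \<open>Column \<open>0\<close> belongs to the rightmost particle
      \<open>l - 1\<close>, which therefore stands at a site \<open>\<ge> l\<close>.\<close>
    then have "column_len u 0 > 0"
      unfolding column_len_def card_gt_0_iff using finite_long_rows[of 0 u] by blast
    then have "alternant l (particles l u) = 0"
      using \<open>0 < l\<close> by (intro alternant_large[of "l - 1"]) (auto simp: particles_def)
    ultimately show ?thesis using len by simp
  qed
next
  case (Suc k)
  let ?i = "length u" and ?y = "particles l u"
  have n: "?i < n" "k = n - Suc ?i" "n - ?i = Suc k" using Suc.hyps(2) by auto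
  \<comment> \<open>\<open>A p\<close>, \<open>F\<close> and, below, \<open>C p\<close> hold the
    involutions whose last rule is \<open>opener\<close>, \<open>fixpoint\<close> and
    \<open>closer\<close>; \<open>p\<close> is the row of the box deleted or inserted.\<close>
  define A where "A p = {\<tau>. growth l n \<tau> (Some p # u)}" for p
  define F where "F = (if row_len u 0 < l then {\<tau>. growth l n \<tau> (None # u)} else {})"
  have "\<forall>p\<in>removable u. \<exists>a w. insertion a w p u \<and> yamanouchi w"
    using insertion_surjective[OF Suc.prems(1)] by (auto simp: removable_def)
  then obtain a w where ins: "\<And>p. p \<in> removable u \<Longrightarrow> insertion (a p) (w p) p u"
      "\<And>p. p \<in> removable u \<Longrightarrow> yamanouchi (w p)"
    by metis
  define C where
    "C p = (\<lambda>\<tau>. \<tau> \<circ> transpose (a p) (Suc ?i)) ` {\<tau>. growth l n \<tau> (None # w p)}" for p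
  have len_w: "length (w p) = ?i" if "p \<in> removable u" for p
    using insertion_length[OF ins(1)[OF that]] by simp
  have A_top: "Suc ?i < \<tau> (Suc ?i)" if "\<tau> \<in> A p" for \<tau> p
    using that coherent_top[OF growth_coherent, of l n \<tau> "Some p" u] by (simp add: A_def)
  have F_top: "\<tau> (Suc ?i) = Suc ?i" if "\<tau> \<in> F" for \<tau>
    using that coherent_top[OF growth_coherent, of l n \<tau> None u] by (simp add: F_def split: if_splits)
  have C_top: "\<tau> (Suc ?i) = a p" "a p < Suc ?i" if "\<tau> \<in> C p" "p \<in> removable u" for \<tau> p
    using that closer_apply(3)[OF _ ins(1)[OF that(2)], of l n] insertion_pos[OF ins(1)[OF that(2)]]
      len_w[OF that(2)] by (auto simp: C_def)
  have A_empty: "p \<in> addable l u" if "\<tau> \<in> A p" for \<tau> p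
  proof -
    have g: "growth l n \<tau> (Some p # u)" using that by (simp add: A_def)
    have "p = 0 \<or> row_len u p < row_len u (p - 1)"
      using growth_coherent[OF g] by (simp add: coherent_def)
    moreover have "row_len u (p - 1) \<le> l"
      using yamanouchi_row_len_antimono[OF Suc.prems(1), of 0 "p - 1"] Suc.prems(2) by simp
    ultimately show ?thesis using growth_row_len[OF g] by (auto simp: addable_def split: if_splits)
  qed
  have split: "{\<tau>. growth l n \<tau> u} = (\<Union>p\<in>addable l u. A p) \<union> F \<union> (\<Union>p\<in>removable u. C p)"
  proof (intro equalityI subsetI)
    fix \<tau> assume "\<tau> \<in> {\<tau>. growth l n \<tau> u}"
    then have "growth l n \<tau> u" by simp
    then show "\<tau> \<in> (\<Union>p\<in>addable l u. A p) \<union> F \<union> (\<Union>p\<in>removable u. C p)"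
      using n(1)
    proof (cases rule: growth_cases_length)
      case (opener p)
      then have "\<tau> \<in> A p" by (simp add: A_def)
      then show ?thesis using A_empty by blast
    next
      case fixpoint
      then show ?thesis by (simp add: F_def)
    next
      case (closer \<sigma> b p v)
      have yam_v: "yamanouchi v"
        using coherent_tl[OF growth_coherent[OF closer(1)]] by (simp add: coherent_def)
      have p: "p \<in> removable u"
        using insertion_row_len[OF closer(2)] yamanouchi_row_len_Suc[OF yam_v, of p]
        by (simp add: removable_def)
      have "b = a p \<and> v = w p" using insertion_injective[OF closer(2) ins(1)[OF p]] .
      then have "\<tau> \<in> C p" using closer by (auto simp: C_def)
      then show ?thesis using p by blast
    qed
  next
    fix \<tau> assume "\<tau> \<in> (\<Union>p\<in>addable l u. A p) \<union> F \<union> (\<Union>p\<in>removable u. C p)"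
    then consider p where "\<tau> \<in> A p" | "\<tau> \<in> F" | p where "p \<in> removable u" "\<tau> \<in> C p" by blast
    then show "\<tau> \<in> {\<tau>. growth l n \<tau> u}"
    proof cases
      case 1
      then show ?thesis by (auto simp: A_def intro: growth.opener)
    next
      case 2
      then show ?thesis by (auto simp: F_def intro: growth.fixpoint split: if_splits)
    next
      case (3 p)
      then obtain \<sigma> where "growth l n \<sigma> (None # w p)" "\<tau> = \<sigma> \<circ> transpose (a p) (Suc ?i)"
        by (auto simp: C_def)
      then show ?thesis
        using growth.closer[of l n \<sigma> "w p" "a p" p u] ins(1)[OF 3(1)] Suc.prems(2) len_w[OF 3(1)]
        by simp
    qed
  qed
  have fin: "finite (A p)" "finite F" "finite (C p)" for p
    by (simp_all add: A_def F_def C_def finite_growth)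
  have A_disj: "A p \<inter> A q = {}" if "p \<noteq> q" for p q
    using that growth_unique[of l n _ "Some p # u" "Some q # u"] by (auto simp: A_def)
  \<comment> \<open>An involution in both sets determines the same \<open>a\<close> and the same
    previous involution, hence by \<open>growth_unique\<close> the same previous tableau; the
    insertion then ends in the same row.\<close>
  have C_disj: "C p \<inter> C q = {}" if pq: "p \<in> removable u" "q \<in> removable u" "p \<noteq> q" for p q
  proof (rule ccontr)
    assume "C p \<inter> C q \<noteq> {}"
    then obtain \<tau> where \<tau>: "\<tau> \<in> C p" "\<tau> \<in> C q" by blast
    then have a: "a p = a q" using C_top(1) pq by metis
    obtain \<sigma> \<rho> where \<sigma>: "growth l n \<sigma> (None # w p)" "\<tau> = \<sigma> \<circ> transpose (a p) (Suc ?i)"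
      and \<rho>: "growth l n \<rho> (None # w q)" "\<tau> = \<rho> \<circ> transpose (a p) (Suc ?i)"
      using \<tau> a by (auto simp: C_def)
    have "\<sigma> = \<rho>" using \<sigma>(2) \<rho>(2) by (metis comp_assoc comp_id transpose_comp_involutory)
    then have "w p = w q"
      using growth_unique[OF \<sigma>(1), of "None # w q"] \<rho>(1) len_w pq by simp
    then show False
      using insertion_deterministic[OF ins(1)[OF pq(1)]] ins(1)[OF pq(2)] a pq(3) by metis
  qed
  have card_A: "of_nat (card (A p)) =
      signed_walks l k (?y(l - 1 - row_len u p := ?y (l - 1 - row_len u p) + 1))"
    if p: "p \<in> addable l u" for p
  proof -
    have "yamanouchi (Some p # u)" "row_len (Some p # u) 0 \<le> l"
      using p Suc.prems by (auto simp: addable_def)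
    then have "of_nat (card (A p)) = signed_walks l k (particles l (Some p # u))"
      using Suc.hyps(1)[of "Some p # u"] n by (simp add: A_def)
    also have "particles l (Some p # u) = ?y(l - 1 - row_len u p := ?y (l - 1 - row_len u p) + 1)"
      using p by (intro particles_add_box) (auto simp: addable_def)
    finally show ?thesis .
  qed
  have particles_None: "particles l (None # v) = particles l v" for v
    by (simp add: particles_def column_len_def fun_eq_iff)
  have card_F: "of_nat (card F) = (if row_len u 0 < l then signed_walks l k ?y else 0)"
    using Suc.hyps(1)[of "None # u"] n Suc.prems by (simp add: F_def particles_None)
  have card_C: "of_nat (card (C p)) =
      signed_walks l k (?y(l - row_len u p := ?y (l - row_len u p) - 1))"
    if p: "p \<in> removable u" for p
  proof -
    have box: "row_len u q = row_len (w p) q + (if q = p then 1 else 0)" for q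
      by (rule insertion_row_len[OF ins(1)[OF p]])
    have "row_len u p \<le> l"
      using yamanouchi_row_len_antimono[OF Suc.prems(1), of 0 p] Suc.prems(2) by simp
    then have col: "row_len (w p) p < l" "l - row_len u p = l - 1 - row_len (w p) p"
      using box[of p] by auto
    have y: "?y = (particles l (w p))(l - row_len u p := particles l (w p) (l - row_len u p) + 1)"
      by (rule particles_add_box[OF box col])
    have "inj_on (\<lambda>\<tau>. \<tau> \<circ> transpose (a p) (Suc ?i)) S" for S :: "(nat \<Rightarrow> nat) set"
      by (rule inj_onI) (metis comp_assoc comp_id transpose_comp_involutory)
    then have "card (C p) = card {\<tau>. growth l n \<tau> (None # w p)}"
      unfolding C_def by (rule card_image)
    moreover have "row_len (w p) 0 \<le> l" using box[of 0] Suc.prems(2) by simp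
    ultimately have "of_nat (card (C p)) = signed_walks l k (particles l (w p))"
      using Suc.hyps(1)[of "None # w p"] n ins(2)[OF p] len_w[OF p] by (simp add: particles_None)
    also have "particles l (w p) = ?y(l - row_len u p := ?y (l - row_len u p) - 1)"
      unfolding y by simp
    finally show ?thesis .
  qed
  have "card {\<tau>. growth l n \<tau> u} = card (\<Union>p\<in>addable l u. A p) + card F + card (\<Union>p\<in>removable u. C p)"
  proof -
    have "(\<Union>p\<in>addable l u. A p) \<inter> F = {}" using A_top F_top by fastforce
    moreover have "((\<Union>p\<in>addable l u. A p) \<union> F) \<inter> (\<Union>p\<in>removable u. C p) = {}"
      using A_top F_top C_top by fastforce
    ultimately show ?thesis
      unfolding split using fin finite_addable finite_removable
      by (subst card_Un_disjoint, auto, subst card_Un_disjoint) auto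
  qed
  also have "card (\<Union>p\<in>addable l u. A p) = (\<Sum>p\<in>addable l u. card (A p))"
    using fin A_disj finite_addable by (intro card_UN_disjoint) auto
  also have "card (\<Union>p\<in>removable u. C p) = (\<Sum>p\<in>removable u. card (C p))"
    using fin C_disj finite_removable by (intro card_UN_disjoint) auto
  finally have "of_nat (card {\<tau>. growth l n \<tau> u}) =
      (\<Sum>p\<in>addable l u. of_nat (card (A p))) + of_nat (card F) +
      (\<Sum>p\<in>removable u. of_nat (card (C p)) :: rat)"
    by simp
  also have "\<dots> = (\<Sum>j<l. signed_walks l k (?y(j := ?y j + 1))) + (\<Sum>j<l. signed_walks l k (?y(j := ?y j - 1)))"
    unfolding sum_up_steps[OF Suc.prems(1)] sum_down_steps[OF Suc.prems(1,2) \<open>0 < l\<close>] card_F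
    using card_A card_C by simp
  also have "\<dots> = signed_walks l (n - ?i) ?y" unfolding n(3) by (simp add: sum.distrib)
  finally show ?case .
qed

text \<open>The reading ends at the empty word, whose empty tableau puts particle \<open>j\<close>
  at site \<open>j\<close>. Values at \<open>l\<close> and beyond do not enter
  \<open>exponent l\<close>.\<close>

lemma card_avoiding:
  assumes "0 < l"
  shows "of_nat (card {\<sigma> \<in> involutions_avoiding (2 * l). fst \<sigma> = n}) =
    Poly_Mapping.lookup (weyl_det l * step_sum l ^ n) (exponent l int)"
proof -
  have "{\<sigma> \<in> involutions_avoiding (2 * l). fst \<sigma> = n} = Pair n ` {\<tau>. growth l n \<tau> []}"
    by (auto simp: avoiding_iff_growth)
  then have "card {\<sigma> \<in> involutions_avoiding (2 * l). fst \<sigma> = n} = card {\<tau>. growth l n \<tau> []}"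
    by (simp add: card_image inj_on_def)
  moreover have "particles l [] = (\<lambda>j. if j < l then int j else 0)"
    by (auto simp: particles_def column_len_def)
  moreover have "exponent l (\<lambda>j. if j < l then int j else 0) = exponent l int"
    by (simp add: exponent_def)
  ultimately show ?thesis
    using card_growth[OF assms, of "[]" n] lookup_signed_walks[of l n "particles l []"] by simp
qed

(* Matrix indices start at 0: position (i, j) is the entry in row i + 1 and column j + 1. *)
theorem proposition10:
  fixes l m :: nat
  assumes "l \<ge> 1" and "m = 2 * l"
  shows
    "ordinary_gf (involutions_avoiding m) fst =
       extract_coeff (staircase l)
         (fps_const (det (mat l l (\<lambda>(i, j). X (Suc j) ^ i + Xbar (Suc j) ^ Suc i))) *
          recip (1 - fps_X * fps_const ((\<Sum>j = 1..l. X j) + (\<Sum>j = 1..l. Xbar j))))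
     \<and>
     exponential_gf (involutions_avoiding m) fst =
       extract_coeff (staircase l)
         (det (mat l l (\<lambda>(i, j). fps_const (X (Suc j) ^ i + Xbar (Suc j) ^ Suc i) *
                                  exp_t (X (Suc j) + Xbar (Suc j)))))"
proof (intro conjI fps_ext)
  fix n
  have l: "0 < l" using assms(1) by simp
  have "fps_nth (ordinary_gf (involutions_avoiding m) fst) n =
      of_nat (card {\<sigma> \<in> involutions_avoiding (2 * l). fst \<sigma> = n})"
    by (simp add: ordinary_gf_def assms(2))
  then show "fps_nth (ordinary_gf (involutions_avoiding m) fst) n =
    fps_nth (extract_coeff (staircase l)
         (fps_const (weyl_det l) * recip (1 - fps_X * fps_const (step_sum l)))) n"
    by (simp only: card_avoiding[OF l] coeff_ordinary staircase_eq_exponent)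
  have "fps_nth (exponential_gf (involutions_avoiding m) fst) n =
      (\<Sum>\<sigma> | \<sigma> \<in> involutions_avoiding (2 * l) \<and> fst \<sigma> = n. 1 / fact n)"
    unfolding exponential_gf_def assms(2) fps_nth_Abs_fps by (rule sum.cong) auto
  also have "\<dots> = 1 / fact n * of_nat (card {\<sigma> \<in> involutions_avoiding (2 * l). fst \<sigma> = n})"
    by simp
  finally show "fps_nth (exponential_gf (involutions_avoiding m) fst) n =
    fps_nth (extract_coeff (staircase l)
      (det (mat l l (\<lambda>(i, j). fps_const (X (Suc j) ^ i + Xbar (Suc j) ^ Suc i) *
                                  exp_t (X (Suc j) + Xbar (Suc j)))))) n"
    by (simp only: card_avoiding[OF l] coeff_exponential staircase_eq_exponent)
qed

end
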